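(* Consider $\mathsf{Broadcast}$ algorithms that must work on every network of maximum degree at most $\Delta$ (in particular on every complete bipartite graph $K_{2,k}$ with $1\le k\le\Delta$, with the source being one of the two vertices of the size-2 side). Then: (i) in the deterministic $\mathsf{No}\text{-}\mathsf{CD}$ model, any such algorithm requires $\Omega(\Delta)$ energy; (ii) in the randomized $\mathsf{No}\text{-}\mathsf{CD}$ model, any such algorithm succeeding with high probability requires $\Omega(\log\Delta\log n)$ energy; (iii) in the randomized $\mathsf{CD}$ model, any such algorithm succeeding with high probability requires $\Omega(\log n)$ energy.
   Context: Radio network model: the network is a connected undirected graph $G=(V,E)$ with $n=|V|$ vertices and maximum degree $\Delta$; vertices know $n$ and $\Delta$ but not the topology. Time is divided into synchronized slots; in each slot a vertex transmits, listens, or is idle. Transmitting or listening costs one unit of energy, idling is free; the energy of an algorithm is the maximum over vertices of the number of slots in which the vertex transmits or listens. A listener with exactly one transmitting neighbor receives that neighbor's message. In $\mathsf{No}\text{-}\mathsf{CD}$, if zero or at least two neighbors transmit, the listener hears silence. In $\mathsf{CD}$, if zero neighbors transmit the listener hears silence, and if at least two transmit it hears a distinct "noise" signal. Transmitters receive no feedback. In the deterministic setting vertices have distinct IDs in $\{1,\ldots,N\}$; in the randomized setting they have private random bits, and "with high probability" means with failure probability at most $1/\mathrm{poly}(n)$. In $\mathsf{Broadcast}$, a source vertex holds a message $m$ and all vertices must learn $m$. *)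

theory Defs
  imports "HOL-Probability.Probability"
begin

datatype 'msg action = Idle | Listen | Transmit (msg_of: 'msg)

datatype 'msg feedback = NoFeedback | Silence | Noise | Received 'msg

definition is_transmit :: "'msg action \<Rightarrow> bool" where
  "is_transmit a \<longleftrightarrow> (\<exists>x. a = Transmit x)"

definition slot_feedback ::
  "bool \<Rightarrow> 'v set \<Rightarrow> ('v \<Rightarrow> 'v \<Rightarrow> bool) \<Rightarrow> ('v \<Rightarrow> 'msg action) \<Rightarrow> 'v \<Rightarrow> 'msg feedback" where
  "slot_feedback cd V adj a v =
     (if a v = Listen then
        (if (\<exists>!u. u \<in> V \<and> adj v u \<and> is_transmit (a u))
         then Received (msg_of (a (THE u. u \<in> V \<and> adj v u \<and> is_transmit (a u))))
         else if cd \<and> (\<exists>u. u \<in> V \<and> adj v u \<and> is_transmit (a u)) then Noise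
         else Silence)
      else NoFeedback)"

text \<open>A (distributed) algorithm is given by an action function \<open>act\<close>: the action of a vertex
  in a slot depends only on its local data \<open>loc v\<close> (ID or private random bits, and whether it
  is the source together with the message) and on the feedback it has received so far.
  \<open>history \<dots> t v\<close> is the feedback list of vertex v in slots 0..t-1.\<close>
primrec history ::
  "bool \<Rightarrow> 'v set \<Rightarrow> ('v \<Rightarrow> 'v \<Rightarrow> bool) \<Rightarrow> ('v \<Rightarrow> 'l) \<Rightarrow> ('l \<Rightarrow> 'msg feedback list \<Rightarrow> 'msg action)
   \<Rightarrow> nat \<Rightarrow> 'v \<Rightarrow> 'msg feedback list" where
  "history cd V adj loc act 0 = (\<lambda>v. [])"
| "history cd V adj loc act (Suc t) =
     (let H = history cd V adj loc act t
      in (\<lambda>v. H v @ [slot_feedback cd V adj (\<lambda>u. act (loc u) (H u)) v]))"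

definition action_at where
  "action_at cd V adj loc act t v = act (loc v) (history cd V adj loc act t v)"

definition energy_of where
  "energy_of cd V adj loc act T v = card {t. t < T \<and> action_at cd V adj loc act t v \<noteq> Idle}"

definition energy_within where
  "energy_within cd V adj loc act T E \<longleftrightarrow> (\<forall>v\<in>V. energy_of cd V adj loc act T v \<le> E)"

definition broadcast_success where
  "broadcast_success cd V adj loc act outp T m \<longleftrightarrow>
     (\<forall>v\<in>V. outp (loc v) (history cd V adj loc act T v) = m)"

definition K2_verts :: "nat \<Rightarrow> nat set" where
  "K2_verts k = {..k+1}"

definition K2_adj :: "nat \<Rightarrow> nat \<Rightarrow> nat \<Rightarrow> bool" where
  "K2_adj k u v \<longleftrightarrow> (u \<le> 1 \<and> 2 \<le> v \<and> v \<le> k+1) \<or> (v \<le> 1 \<and> 2 \<le> u \<and> u \<le> k+1)"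

definition src_in :: "nat \<Rightarrow> nat \<Rightarrow> nat option" where
  "src_in m v = (if v = 0 then Some m else None)"

definition det_K2_correct ::
  "bool \<Rightarrow> nat \<Rightarrow> nat \<Rightarrow> (nat \<times> nat option \<Rightarrow> 'msg feedback list \<Rightarrow> 'msg action)
   \<Rightarrow> (nat \<times> nat option \<Rightarrow> 'msg feedback list \<Rightarrow> nat) \<Rightarrow> nat \<Rightarrow> bool" where
  "det_K2_correct cd N \<Delta> act outp T \<longleftrightarrow>
     (\<forall>k\<in>{1..\<Delta>}. \<forall>id. inj_on id (K2_verts k) \<and> id ` K2_verts k \<subseteq> {1..N} \<longrightarrow>
        (\<forall>m. broadcast_success cd (K2_verts k) (K2_adj k) (\<lambda>v. (id v, src_in m v)) act outp T m))"

definition det_K2_energy ::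
  "bool \<Rightarrow> nat \<Rightarrow> nat \<Rightarrow> (nat \<times> nat option \<Rightarrow> 'msg feedback list \<Rightarrow> 'msg action) \<Rightarrow> nat \<Rightarrow> nat \<Rightarrow> bool" where
  "det_K2_energy cd N \<Delta> act T E \<longleftrightarrow>
     (\<forall>k\<in>{1..\<Delta>}. \<forall>id. inj_on id (K2_verts k) \<and> id ` K2_verts k \<subseteq> {1..N} \<longrightarrow>
        (\<forall>m. energy_within cd (K2_verts k) (K2_adj k) (\<lambda>v. (id v, src_in m v)) act T E))"

text \<open>\<open>\<omega> v i\<close> is the i-th private random bit of vertex v; all bits independent and fair.\<close>
definition coin_space :: "(nat \<Rightarrow> nat \<Rightarrow> bool) measure" where
  "coin_space = (\<Pi>\<^sub>M v\<in>UNIV. \<Pi>\<^sub>M i\<in>UNIV. measure_pmf (pmf_of_set (UNIV :: bool set)))"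

text \<open>Success with probability at least 1 - n^(-c) (inner measure: the success event contains
  a measurable event of that probability), for every k and every message.\<close>
definition rand_K2_whp ::
  "bool \<Rightarrow> nat \<Rightarrow> real \<Rightarrow> nat \<Rightarrow> ((nat \<Rightarrow> bool) \<times> nat option \<Rightarrow> 'msg feedback list \<Rightarrow> 'msg action)
   \<Rightarrow> ((nat \<Rightarrow> bool) \<times> nat option \<Rightarrow> 'msg feedback list \<Rightarrow> nat) \<Rightarrow> nat \<Rightarrow> bool" where
  "rand_K2_whp cd n c \<Delta> act outp T \<longleftrightarrow>
     (\<forall>k\<in>{1..\<Delta>}. \<forall>m. \<exists>S\<in>sets coin_space.
        S \<subseteq> {\<omega>. broadcast_success cd (K2_verts k) (K2_adj k) (\<lambda>v. (\<omega> v, src_in m v)) act outp T m}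
        \<and> measure coin_space S \<ge> 1 - 1 / (real n powr c))"

definition rand_K2_energy ::
  "bool \<Rightarrow> nat \<Rightarrow> ((nat \<Rightarrow> bool) \<times> nat option \<Rightarrow> 'msg feedback list \<Rightarrow> 'msg action) \<Rightarrow> nat \<Rightarrow> nat \<Rightarrow> bool" where
  "rand_K2_energy cd \<Delta> act T E \<longleftrightarrow>
     (\<forall>k\<in>{1..\<Delta>}. \<forall>m \<omega>. energy_within cd (K2_verts k) (K2_adj k) (\<lambda>v. (\<omega> v, src_in m v)) act T E)"

end

theory Submission
  imports Defs
begin

text \<open>
  In \<open>K\<^bsub>2,k\<^esub>\<close> call the source and the other vertex of the small side hubs, the rest leaves. As long as no
  slot in which a hub listens has exactly one transmitting leaf, the hubs learn nothing but silence
  and noise. The hubs listen in at most \<open>2E\<close> slots.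

  Deterministic, no collision detection: while some listening slot has exactly one transmitter among
  the current leaves, delete that leaf. This takes at most one deletion per slot, so some leaf survives
  unless there are \<open>\<Delta>\<close> listening slots.

  In the randomized models, draw the leaves from a population of \<open>M\<close> vertices with fixed random strings,
  where \<open>M\<close> tends to infinity.

  Collision detection: take \<open>k = 2\<close>. In each listening slot, go on with the larger one of the two classes
  of vertices that would or would not transmit. At least a fraction \<open>1 / 4 ^ E\<close> of the population remains,
  and two of its members cause only silence and noise. The resulting pattern of noise depends on the message,
  but there are only \<open>2 ^ T\<close> patterns, so most of a sufficiently large set of messages cannot be told from it.

  Randomized, no collision detection: take \<open>k = 2K\<close> and let \<open>U\<close> be the set of listening slots in which at
  least one of \<open>K\<close> independent leaves would transmit during a silent run. If the two halves of the leaves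
  produce the same set \<open>U\<close>, no slot has exactly one transmitter. This collision has probability at least
  \<open>exp (- H U)\<close>, and by subadditivity \<open>H U\<close> is at most the sum of \<open>h ((1 - p) ^ K)\<close> over the listening slots,
  where \<open>p\<close> is the probability that a leaf transmits in the slot. For a fixed slot, the sum of these terms
  over all \<open>K = 2 ^ i\<close> is bounded, so on average over \<open>log \<Delta>\<close> scales the entropy is \<open>O(E / log \<Delta>)\<close>.
\<close>

section \<open>Inequalities\<close>

lemma one_div_powr_le_one_div:
  assumes "1 \<le> c" "1 \<le> x"
  shows "1 / x powr c \<le> 1 / (x :: real)"
  using powr_mono[OF assms] assms(2) by (simp add: frac_le)

lemma le_if_le_add_divide_nat:
  fixes x y c :: real
  assumes "\<And>M :: nat. 0 < M \<Longrightarrow> x \<le> y + c / real M"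
  shows "x \<le> y"
proof (rule LIMSEQ_le_const)
  show "(\<lambda>M. y + c / real M) \<longlonglongrightarrow> y" using tendsto_add[OF tendsto_const lim_const_over_n] by fastforce
  show "\<exists>M0. \<forall>M\<ge>M0. x \<le> y + c / real M" using assms by (intro exI[of _ 1]) simp
qed

lemma exp_mean_le_mean_exp:
  fixes x :: "'a \<Rightarrow> real"
  assumes "finite A" "A \<noteq> {}"
  shows "exp ((\<Sum>a\<in>A. x a) / real (card A)) \<le> (\<Sum>a\<in>A. exp (x a)) / real (card A)"
  using convex_on_sum[OF assms exp_convex, of "\<lambda>_. 1 / real (card A)" x] assms
  by (simp add: sum_divide_distrib)

lemma (in prob_space) exists_le_expectation:
  fixes X :: "'a \<Rightarrow> real"
  assumes "integrable M X"
  shows "\<exists>\<omega>\<in>space M. X \<omega> \<le> expectation X"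
proof (rule ccontr)
  assume "\<not> (\<exists>\<omega>\<in>space M. X \<omega> \<le> expectation X)"
  hence "expectation X < expectation X" by (intro expectation_greater assms AE_I2) auto
  thus False by simp
qed

section \<open>Counting\<close>

definition tuples :: "'a set \<Rightarrow> nat \<Rightarrow> 'a list set" where
  "tuples V k = {xs. set xs \<subseteq> V \<and> length xs = k}"

lemma finite_tuples [simp]:
  assumes "finite V"
  shows "finite (tuples V k)"
  using assms by (simp add: tuples_def finite_lists_length_eq)

lemma card_tuples:
  assumes "finite V"
  shows "card (tuples V k) = card V ^ k"
  using assms by (simp add: tuples_def card_lists_length_eq)

lemma card_not_distinct_tuples_le:
  assumes "finite V"
  shows "card V * card {xs \<in> tuples V k. \<not> distinct xs} \<le> k\<^sup>2 * card V ^ k"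
proof (induction k)
  case (Suc k)
  define bad where "bad k = {xs \<in> tuples V k. \<not> distinct xs}" for k
  define repeated where "repeated = (SIGMA xs:tuples V k. set xs)"
  have "bad (Suc k) \<subseteq> (\<lambda>(xs, x). x # xs) ` (bad k \<times> V \<union> repeated)"
  proof
    fix xs assume "xs \<in> bad (Suc k)"
    moreover then obtain x ys where "xs = x # ys" by (cases xs) (auto simp: bad_def tuples_def)
    ultimately show "xs \<in> (\<lambda>(xs, x). x # xs) ` (bad k \<times> V \<union> repeated)"
      by (intro image_eqI[of _ _ "(ys, x)"]) (auto simp: bad_def repeated_def tuples_def)
  qed
  moreover have "finite (bad k \<times> V \<union> repeated)" using assms by (simp add: bad_def repeated_def)
  ultimately have "card (bad (Suc k)) \<le> card (bad k \<times> V \<union> repeated)"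
    by (rule surj_card_le[rotated])
  also have "\<dots> \<le> card (bad k) * card V + card repeated"
    using card_Un_le[of "bad k \<times> V" repeated] by (simp add: card_cartesian_product)
  also have "card repeated = (\<Sum>xs\<in>tuples V k. card (set xs))" using assms by (simp add: repeated_def)
  also have "\<dots> \<le> (\<Sum>xs\<in>tuples V k. k)"
    by (intro sum_mono) (auto simp: tuples_def intro: card_length)
  finally have "card V * card (bad (Suc k)) \<le> card V * (card V * card (bad k) + k * card V ^ k)"
    by (simp add: card_tuples assms mult.commute)
  also have "\<dots> \<le> card V * (k\<^sup>2 * card V ^ k + k * card V ^ k)"
    using Suc.IH unfolding bad_def by (intro mult_le_mono2 add_le_mono1)
  also have "\<dots> \<le> (Suc k)\<^sup>2 * card V ^ Suc k" by (simp add: power2_eq_square algebra_simps)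
  finally show ?case unfolding bad_def .
qed (auto simp: tuples_def)

lemma ex1_if_length_filter_eq_1:
  assumes "length (filter P xs) = 1"
  shows "\<exists>!x. x \<in> set xs \<and> P x"
proof -
  obtain x where "filter P xs = [x]" using assms by (auto simp: length_Suc_conv)
  hence "set (filter P xs) = {x}" by simp
  hence "{x \<in> set xs. P x} = {x}" by simp
  thus ?thesis by (intro ex1I[of _ x]) blast+
qed

lemma length_filter_append_neq_1:
  assumes "(\<exists>x\<in>set xs. P x) \<longleftrightarrow> (\<exists>y\<in>set ys. P y)"
  shows "length (filter P (xs @ ys)) \<noteq> 1"
proof (cases "\<exists>x\<in>set xs. P x")
  case True
  hence "filter P xs \<noteq> []" "filter P ys \<noteq> []" using assms by (auto simp: filter_empty_conv)
  thus ?thesis by (cases "filter P xs"; cases "filter P ys") auto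
next
  case False
  hence "filter P (xs @ ys) = []" using assms by (auto simp: filter_empty_conv)
  thus ?thesis by simp
qed

text \<open>Delete, one after the other, elements that are alone in some \<open>F t\<close>: each \<open>t\<close> causes at most
  one deletion.\<close>
lemma exists_subset_without_singles:
  assumes "finite L" "finite P" "card L < card P"
  shows "\<exists>G\<subseteq>P. G \<noteq> {} \<and> (\<forall>t\<in>L. \<nexists>!x. x \<in> G \<and> F t x)"
  using assms
proof (induction "card L" arbitrary: L P)
  case 0
  thus ?case by (intro exI[of _ P]) auto
next
  case (Suc n)
  show ?case
  proof (cases "\<forall>t\<in>L. \<nexists>!x. x \<in> P \<and> F t x")
    case True
    thus ?thesis using Suc.prems by (intro exI[of _ P]) auto
  next
    case False
    then obtain t x where removed: "t \<in> L" "x \<in> P" and alone: "\<And>y. y \<in> P \<Longrightarrow> F t y \<Longrightarrow> y = x" by blast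
    have "card (L - {t}) < card (P - {x})" "n = card (L - {t})" using removed Suc.prems Suc.hyps(2) by simp_all
    then obtain G where smaller: "G \<subseteq> P - {x}" "G \<noteq> {}" "\<forall>t'\<in>L - {t}. \<nexists>!x. x \<in> G \<and> F t' x"
      using Suc.hyps(1)[of "L - {t}" "P - {x}"] Suc.prems by auto
    have "\<nexists>!y. y \<in> G \<and> F t y" using alone smaller(1) by blast
    thus ?thesis using smaller by (intro exI[of _ G]) blast
  qed
qed

lemma card_bool_fibres:
  fixes P :: "'a \<Rightarrow> bool"
  assumes "finite A"
  shows "card A = card {x \<in> A. P x = True} + card {x \<in> A. P x = False}"
  using assms by (subst card_Un_disjoint[symmetric]) (auto intro: arg_cong[where f = card])

lemma exists_majority_value:
  fixes P :: "'a \<Rightarrow> bool"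
  assumes "finite A"
  shows "\<exists>c. card A \<le> card {x \<in> A. P x = c} * 2"
proof -
  have "card A \<le> card {x \<in> A. P x = True} * 2 \<or> card A \<le> card {x \<in> A. P x = False} * 2"
    using card_bool_fibres[OF assms, of P] by linarith
  thus ?thesis by blast
qed

text \<open>Whenever \<open>L\<close> holds, continue \<open>N\<close> with the value that \<open>F\<close> takes on most of the remaining elements.\<close>
lemma exists_majority_pattern:
  fixes L :: "(nat \<Rightarrow> bool) \<Rightarrow> nat \<Rightarrow> bool" and F :: "(nat \<Rightarrow> bool) \<Rightarrow> nat \<Rightarrow> 'x \<Rightarrow> bool"
  assumes "finite P"
    and prefix: "\<And>N N' t. (\<And>s. s < t \<Longrightarrow> N s = N' s) \<Longrightarrow> L N t = L N' t \<and> F N t = F N' t"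
  shows "\<exists>N. \<exists>A\<subseteq>P. card P \<le> card A * 2 ^ card {t. t < T \<and> L N t} \<and>
    (\<forall>t\<in>{t. t < T \<and> L N t}. \<forall>x\<in>A. F N t x = N t)"
proof (induction T)
  case 0
  show ?case by (intro exI[of _ "\<lambda>_. False"] exI[of _ P]) simp
next
  case (Suc T)
  then obtain N A where subset: "A \<subseteq> P" and card: "card P \<le> card A * 2 ^ card {t. t < T \<and> L N t}"
    and agree: "\<And>t x. t < T \<Longrightarrow> L N t \<Longrightarrow> x \<in> A \<Longrightarrow> F N t x = N t" by blast
  have "finite A" using subset \<open>finite P\<close> finite_subset by blast
  then obtain c where majority: "card A \<le> card {x \<in> A. F N T x = c} * 2"
    using exists_majority_value by blast
  define N' where "N' = N(T := c)"
  define A' where "A' = (if L N T then {x \<in> A. F N T x = c} else A)"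
  have same: "L N' t = L N t" "F N' t = F N t" if "t \<le> T" for t
    using prefix[of t N' N] that by (auto simp: N'_def)
  have "{t. t < Suc T \<and> L N' t} = {t. t < T \<and> L N t} \<union> (if L N T then {T} else {})"
    using same by (auto simp: less_Suc_eq)
  hence "card {t. t < Suc T \<and> L N' t} = card {t. t < T \<and> L N t} + (if L N T then 1 else 0)" by simp
  moreover have "card A \<le> card A' * (if L N T then 2 else 1)" using majority by (simp add: A'_def)
  hence "card P \<le> card A' * (if L N T then 2 else 1) * 2 ^ card {t. t < T \<and> L N t}"
    using card by (meson le_trans mult_le_mono1)
  ultimately have "card P \<le> card A' * 2 ^ card {t. t < Suc T \<and> L N' t}"
    by (auto simp: mult.assoc)
  moreover have "F N' t x = N' t" if "t < Suc T" "L N' t" "x \<in> A'" for t x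
    using that agree[of t x] same[of t] by (auto simp: A'_def N'_def less_Suc_eq split: if_splits)
  moreover have "A' \<subseteq> P" using subset by (auto simp: A'_def)
  ultimately show ?case by blast
qed

section \<open>Entropy and collisions\<close>

text \<open>It vanishes at \<open>0\<close> and \<open>1\<close>, because \<open>ln 0 = 0\<close>.\<close>
definition binary_entropy :: "real \<Rightarrow> real" where
  "binary_entropy q = - (q * ln q) - (1 - q) * ln (1 - q)"

lemma neg_mult_ln_le_sqrt:
  assumes "0 \<le> q"
  shows "- (q * ln q) \<le> 2 * (sqrt q - q)"
proof (cases "q = 0")
  case False
  hence sqrt_pos: "0 < sqrt q" and q_eq: "q = sqrt q * sqrt q" using assms by simp_all
  have "ln (1 / sqrt q) \<le> 1 / sqrt q - 1" using sqrt_pos by (intro ln_le_minus_one) simp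
  hence "- ln (sqrt q) \<le> 1 / sqrt q - 1" using sqrt_pos by (simp add: ln_div)
  hence "q * (- ln (sqrt q)) \<le> q * (1 / sqrt q - 1)" using assms by (rule mult_left_mono)
  also have "\<dots> = sqrt q - q" using sqrt_pos by (subst (1 3) q_eq) (simp add: field_simps)
  finally show ?thesis using sqrt_pos by (simp add: ln_sqrt)
qed simp

text \<open>The function \<open>\<lambda>q. sqrt q - sqrt (1 - q)\<close> maps into \<open>{-1..1}\<close>, so these bounds telescope to a constant
  along the sequence \<open>q ^ 2 ^ i\<close>.\<close>
lemma binary_entropy_le_telescoping:
  assumes "0 \<le> q" "q \<le> 1"
  shows "binary_entropy q \<le> 5 * ((sqrt q - sqrt (1 - q)) - (sqrt (q\<^sup>2) - sqrt (1 - q\<^sup>2)))"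
proof -
  define e where "e = sqrt (1 - q)"
  have e_bounds: "0 \<le> e" "e * e = 1 - q" "e \<le> 1" using assms by (auto simp: e_def)
  have "q * q \<le> q" using assms by (simp add: mult_left_le)
  hence "q \<le> sqrt q" using assms by (intro real_le_rsqrt) (auto simp: power2_eq_square)
  have "(1 + 2/5 * q)\<^sup>2 \<le> 1 + q" using \<open>q * q \<le> q\<close> assms by (simp add: power2_eq_square algebra_simps)
  hence "e * (1 + 2/5 * q) \<le> e * sqrt (1 + q)" using e_bounds(1) by (intro mult_left_mono real_le_rsqrt)
  also have "\<dots> = sqrt (1 - q\<^sup>2)"
    by (simp add: e_def real_sqrt_mult[symmetric] power2_eq_square algebra_simps)
  finally have "e + 2/5 * (e * q) \<le> sqrt (1 - q\<^sup>2)" by (simp add: algebra_simps)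
  moreover have "e * (1 - e) \<le> e * q"
    using e_bounds mult_left_le[OF e_bounds(3,1)] by (intro mult_left_mono) auto
  moreover have "- (q * ln q) \<le> 2 * (sqrt q - q)" "- ((1 - q) * ln (1 - q)) \<le> 2 * (e - e * e)"
    using neg_mult_ln_le_sqrt[of q] neg_mult_ln_le_sqrt[of "1 - q"] assms e_bounds by (simp_all add: e_def)
  ultimately show ?thesis
    using \<open>q \<le> sqrt q\<close> assms unfolding binary_entropy_def e_def[symmetric] by (simp add: right_diff_distrib)
qed

lemma sum_binary_entropy_dyadic_le:
  assumes "0 \<le> q" "q \<le> 1"
  shows "(\<Sum>i<I. binary_entropy (q ^ 2 ^ i)) \<le> 10"
proof -
  define \<phi> where "\<phi> i = sqrt (q ^ 2 ^ i) - sqrt (1 - q ^ 2 ^ i)" for i :: nat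
  have range: "0 \<le> q ^ 2 ^ i" "q ^ 2 ^ i \<le> 1" for i :: nat using assms by (auto simp: power_le_one)
  have "binary_entropy (q ^ 2 ^ i) \<le> 5 * (\<phi> i - \<phi> (Suc i))" for i
  proof -
    have "q ^ 2 ^ Suc i = (q ^ 2 ^ i)\<^sup>2" by (simp add: power_mult[symmetric] mult.commute)
    thus ?thesis using binary_entropy_le_telescoping[OF range, of i] unfolding \<phi>_def by simp
  qed
  hence "(\<Sum>i<I. binary_entropy (q ^ 2 ^ i)) \<le> (\<Sum>i<I. 5 * (\<phi> i - \<phi> (Suc i)))" by (intro sum_mono)
  also have "\<dots> = 5 * (\<phi> 0 - \<phi> I)" by (simp only: sum_distrib_left[symmetric] sum_lessThan_telescope')
  also have "\<dots> \<le> 10"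
  proof -
    have sqrt_bounds: "0 \<le> sqrt (q ^ 2 ^ i)" "sqrt (q ^ 2 ^ i) \<le> 1"
      "0 \<le> sqrt (1 - q ^ 2 ^ i)" "sqrt (1 - q ^ 2 ^ i) \<le> 1" for i
      using range[of i] by auto
    have "\<phi> i \<le> 1 \<and> - 1 \<le> \<phi> i" for i unfolding \<phi>_def using sqrt_bounds[of i] by linarith
    from this[of 0] this[of I] show ?thesis by simp
  qed
  finally show ?thesis .
qed

definition relative_frequency :: "'a set \<Rightarrow> ('a \<Rightarrow> 'b) \<Rightarrow> 'b \<Rightarrow> real" where
  "relative_frequency \<Omega> U u = real (card {g \<in> \<Omega>. U g = u}) / real (card \<Omega>)"

lemma relative_frequency_nonneg: "0 \<le> relative_frequency \<Omega> U u"
  by (simp add: relative_frequency_def)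

lemma relative_frequency_le_1:
  assumes "finite \<Omega>"
  shows "relative_frequency \<Omega> U u \<le> 1"
  using assms card_mono[of \<Omega> "{g \<in> \<Omega>. U g = u}"] by (auto simp: relative_frequency_def divide_le_eq)

lemma relative_frequency_pos:
  assumes "finite \<Omega>" "g \<in> \<Omega>"
  shows "0 < relative_frequency \<Omega> U (U g)"
proof -
  have "{h \<in> \<Omega>. U h = U g} \<noteq> {}" "\<Omega> \<noteq> {}" using assms(2) by auto
  thus ?thesis using assms(1) by (simp add: relative_frequency_def card_gt_0_iff)
qed

lemma relative_frequency_True:
  assumes "finite \<Omega>" "\<Omega> \<noteq> {}"
  shows "relative_frequency \<Omega> P True = 1 - relative_frequency \<Omega> P False"
proof -
  have "relative_frequency \<Omega> P True + relative_frequency \<Omega> P False = real (card \<Omega>) / real (card \<Omega>)"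
    unfolding relative_frequency_def add_divide_distrib[symmetric] of_nat_add[symmetric]
    by (subst card_bool_fibres[OF assms(1), of P]) simp
  thus ?thesis using assms by (simp add: card_gt_0_iff)
qed

lemma relative_frequency_tuples:
  assumes "finite V"
  shows "relative_frequency (tuples V K) (\<lambda>xs. \<exists>x\<in>set xs. P x) False =
    relative_frequency V P False ^ K"
proof -
  have "{xs \<in> tuples V K. (\<exists>x\<in>set xs. P x) = False} = tuples {x \<in> V. P x = False} K"
    by (auto simp: tuples_def)
  thus ?thesis
    using assms by (simp add: relative_frequency_def card_tuples power_divide)
qed

lemma Gibbs_inequality:
  assumes "finite \<Omega>" "finite B" "U ` \<Omega> \<subseteq> B"
    and subdistribution: "\<And>u. u \<in> B \<Longrightarrow> 0 \<le> Q u" "(\<Sum>u\<in>B. Q u) \<le> 1" "\<And>g. g \<in> \<Omega> \<Longrightarrow> 0 < Q (U g)"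
  shows "(\<Sum>g\<in>\<Omega>. ln (Q (U g))) \<le> (\<Sum>g\<in>\<Omega>. ln (relative_frequency \<Omega> U (U g)))"
proof -
  let ?p = "relative_frequency \<Omega> U"
  have "(\<Sum>g\<in>\<Omega>. ln (Q (U g)) - ln (?p (U g))) \<le> (\<Sum>g\<in>\<Omega>. Q (U g) / ?p (U g) - 1)"
  proof (rule sum_mono)
    fix g assume "g \<in> \<Omega>"
    hence "0 < Q (U g)" "0 < ?p (U g)" using subdistribution(3) relative_frequency_pos[OF assms(1)] by auto
    thus "ln (Q (U g)) - ln (?p (U g)) \<le> Q (U g) / ?p (U g) - 1"
      using ln_le_minus_one[of "Q (U g) / ?p (U g)"] by (simp add: ln_div)
  qed
  also have "\<dots> = (\<Sum>u\<in>B. real (card {g \<in> \<Omega>. U g = u}) * (Q u / ?p u)) - real (card \<Omega>)"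
    using sum_fun_comp[OF assms(1-3), of "\<lambda>u. Q u / ?p u"] by (simp add: sum_subtractf)
  also have "\<dots> \<le> (\<Sum>u\<in>B. real (card \<Omega>) * Q u) - real (card \<Omega>)"
    using subdistribution(1) by (intro diff_right_mono sum_mono) (auto simp: relative_frequency_def)
  also have "\<dots> \<le> 0" using subdistribution(2) by (simp add: mult_left_le flip: sum_distrib_left)
  finally show ?thesis by (simp add: sum_subtractf)
qed

lemma sum_ln_relative_frequency_bool:
  assumes "finite \<Omega>"
  shows "(\<Sum>g\<in>\<Omega>. ln (relative_frequency \<Omega> P (P g))) =
    - (real (card \<Omega>) * binary_entropy (relative_frequency \<Omega> P False))"
proof (cases "\<Omega> = {}")
  case False
  have count: "real (card {g \<in> \<Omega>. P g = b}) = real (card \<Omega>) * relative_frequency \<Omega> P b" for b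
    using assms False by (simp add: relative_frequency_def)
  have "(\<Sum>g\<in>\<Omega>. ln (relative_frequency \<Omega> P (P g))) =
      (\<Sum>b\<in>UNIV. real (card {g \<in> \<Omega>. P g = b}) * ln (relative_frequency \<Omega> P b))"
    by (rule sum_fun_comp[OF assms]) auto
  thus ?thesis
    unfolding count UNIV_bool using relative_frequency_True[OF assms False]
    by (simp add: binary_entropy_def algebra_simps)
qed simp

definition collisions :: "'a set \<Rightarrow> ('a \<Rightarrow> 'b) \<Rightarrow> ('a \<times> 'a) set" where
  "collisions \<Omega> U = {(g, g'). g \<in> \<Omega> \<and> g' \<in> \<Omega> \<and> U g = U g'}"

lemma card_collisions_ge_exp_mean_ln:
  assumes "finite \<Omega>" "\<Omega> \<noteq> {}"
  shows "(real (card \<Omega>))\<^sup>2 * exp ((\<Sum>g\<in>\<Omega>. ln (relative_frequency \<Omega> U (U g))) / real (card \<Omega>))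
    \<le> real (card (collisions \<Omega> U))"
proof -
  define N where "N = real (card \<Omega>)"
  have "0 < N" using assms by (simp add: N_def card_gt_0_iff)
  have "N\<^sup>2 * exp ((\<Sum>g\<in>\<Omega>. ln (relative_frequency \<Omega> U (U g))) / N)
      \<le> N\<^sup>2 * ((\<Sum>g\<in>\<Omega>. exp (ln (relative_frequency \<Omega> U (U g)))) / N)"
    unfolding N_def by (intro mult_left_mono exp_mean_le_mean_exp assms) simp
  also have "(\<Sum>g\<in>\<Omega>. exp (ln (relative_frequency \<Omega> U (U g)))) = (\<Sum>g\<in>\<Omega>. relative_frequency \<Omega> U (U g))"
    by (intro sum.cong refl exp_ln relative_frequency_pos assms(1))
  also have "N\<^sup>2 * (\<dots> / N) = N * (\<Sum>g\<in>\<Omega>. relative_frequency \<Omega> U (U g))"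
    using \<open>0 < N\<close> by (simp add: power2_eq_square)
  also have "\<dots> = (\<Sum>g\<in>\<Omega>. real (card {g' \<in> \<Omega>. U g' = U g}))"
    using \<open>0 < N\<close> by (simp add: relative_frequency_def N_def flip: sum_divide_distrib)
  also have "\<dots> = real (card (SIGMA g:\<Omega>. {g' \<in> \<Omega>. U g' = U g}))" using assms(1) by simp
  also have "(SIGMA g:\<Omega>. {g' \<in> \<Omega>. U g' = U g}) = collisions \<Omega> U" by (auto simp: collisions_def)
  finally show ?thesis unfolding N_def .
qed

lemma sum_Pow_prod_if:
  fixes a b :: "'a \<Rightarrow> 'c :: comm_semiring_1"
  assumes "finite L"
  shows "(\<Sum>u\<in>Pow L. \<Prod>j\<in>L. if j \<in> u then a j else b j) = (\<Prod>j\<in>L. a j + b j)"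
  unfolding prod_add[OF assms] using assms
  by (intro sum.cong refl) (simp add: prod.If_cases Int_absorb1 Diff_eq)

text \<open>Subadditivity of entropy: compare the distribution of \<open>U\<close> with the product of its marginals.\<close>
lemma card_collisions_ge_exp_entropy:
  fixes U :: "'a \<Rightarrow> 'b set"
  assumes "finite \<Omega>" "\<Omega> \<noteq> {}" "finite L" "\<And>g. g \<in> \<Omega> \<Longrightarrow> U g \<subseteq> L"
  shows "(real (card \<Omega>))\<^sup>2 * exp (- (\<Sum>j\<in>L. binary_entropy (relative_frequency \<Omega> (\<lambda>g. j \<in> U g) False)))
    \<le> real (card (collisions \<Omega> U))"
proof -
  define marginal where "marginal j = relative_frequency \<Omega> (\<lambda>g. j \<in> U g)" for j
  define Q where "Q u = (\<Prod>j\<in>L. marginal j (j \<in> u))" for u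
  have marginal_pos: "0 < marginal j (j \<in> U g)" if "g \<in> \<Omega>" for j g
    unfolding marginal_def using relative_frequency_pos[OF assms(1) that, of "\<lambda>g. j \<in> U g"] .
  have "(\<Sum>u\<in>Pow L. Q u) = (\<Sum>u\<in>Pow L. \<Prod>j\<in>L. if j \<in> u then marginal j True else marginal j False)"
    unfolding Q_def by (intro sum.cong prod.cong) auto
  also have "\<dots> = 1"
    by (simp add: sum_Pow_prod_if assms(3) marginal_def relative_frequency_True[OF assms(1,2)])
  finally have Q_sum: "(\<Sum>u\<in>Pow L. Q u) \<le> 1" by simp
  have "- (real (card \<Omega>) * (\<Sum>j\<in>L. binary_entropy (marginal j False))) = (\<Sum>j\<in>L. \<Sum>g\<in>\<Omega>. ln (marginal j (j \<in> U g)))"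
    unfolding marginal_def by (simp add: sum_ln_relative_frequency_bool[OF assms(1)] sum_distrib_left sum_negf)
  also have "\<dots> = (\<Sum>g\<in>\<Omega>. ln (Q (U g)))"
    unfolding Q_def
    by (subst sum.swap)
      (intro sum.cong refl ln_prod[symmetric] assms(3) marginal_pos[THEN less_imp_neq, THEN not_sym])
  also have "\<dots> \<le> (\<Sum>g\<in>\<Omega>. ln (relative_frequency \<Omega> U (U g)))"
  proof (rule Gibbs_inequality)
    show "0 \<le> Q u" for u unfolding Q_def marginal_def by (intro prod_nonneg relative_frequency_nonneg)
    show "0 < Q (U g)" if "g \<in> \<Omega>" for g unfolding Q_def using marginal_pos[OF that] by (intro prod_pos)
  qed (use assms Q_sum in auto)
  finally have "- (\<Sum>j\<in>L. binary_entropy (marginal j False))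
      \<le> (\<Sum>g\<in>\<Omega>. ln (relative_frequency \<Omega> U (U g))) / real (card \<Omega>)"
    using assms(1,2) by (simp add: field_simps card_gt_0_iff)
  hence "(real (card \<Omega>))\<^sup>2 * exp (- (\<Sum>j\<in>L. binary_entropy (marginal j False)))
      \<le> (real (card \<Omega>))\<^sup>2 * exp ((\<Sum>g\<in>\<Omega>. ln (relative_frequency \<Omega> U (U g))) / real (card \<Omega>))"
    by (intro mult_left_mono) auto
  thus ?thesis
    using card_collisions_ge_exp_mean_ln[OF assms(1,2), of U] unfolding marginal_def by linarith
qed

section \<open>Executions on complete bipartite graphs\<close>

type_synonym ('l, 'msg) algorithm = "'l \<Rightarrow> 'msg feedback list \<Rightarrow> 'msg action"

abbreviation K2_feedback :: "bool \<Rightarrow> nat \<Rightarrow> (nat \<Rightarrow> 'msg action) \<Rightarrow> nat \<Rightarrow> 'msg feedback" where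
  "K2_feedback cd k \<equiv> slot_feedback cd (K2_verts k) (K2_adj k)"

abbreviation K2_history ::
  "bool \<Rightarrow> nat \<Rightarrow> (nat \<Rightarrow> 'l) \<Rightarrow> ('l, 'msg) algorithm \<Rightarrow> nat \<Rightarrow> nat \<Rightarrow> 'msg feedback list" where
  "K2_history cd k \<equiv> history cd (K2_verts k) (K2_adj k)"

abbreviation K2_broadcast_success ::
  "bool \<Rightarrow> nat \<Rightarrow> (nat \<Rightarrow> 'l) \<Rightarrow> ('l, 'msg) algorithm \<Rightarrow> ('l \<Rightarrow> 'msg feedback list \<Rightarrow> 'a) \<Rightarrow> nat \<Rightarrow> 'a \<Rightarrow> bool" where
  "K2_broadcast_success cd k \<equiv> broadcast_success cd (K2_verts k) (K2_adj k)"

abbreviation no_noise :: "nat \<Rightarrow> bool" where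
  "no_noise \<equiv> \<lambda>_. False"

lemma slot_feedback_cong:
  assumes "\<alpha> v = \<beta> w"
    and "\<And>u. u \<in> V \<and> adj v u \<longleftrightarrow> u \<in> W \<and> adj' w u"
    and "\<And>u. u \<in> V \<Longrightarrow> adj v u \<Longrightarrow> \<alpha> u = \<beta> u"
  shows "slot_feedback cd V adj \<alpha> v = slot_feedback cd W adj' \<beta> w"
proof -
  have same: "u \<in> V \<and> adj v u \<and> is_transmit (\<alpha> u) \<longleftrightarrow> u \<in> W \<and> adj' w u \<and> is_transmit (\<beta> u)" for u
    using assms(2,3)[of u] by auto
  have "\<alpha> (THE u. u \<in> W \<and> adj' w u \<and> is_transmit (\<beta> u)) = \<beta> (THE u. u \<in> W \<and> adj' w u \<and> is_transmit (\<beta> u))"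
    if "\<exists>!u. u \<in> W \<and> adj' w u \<and> is_transmit (\<beta> u)"
    using theI'[OF that] by (intro assms(3)) (use assms(2) in blast)+
  thus ?thesis unfolding slot_feedback_def same assms(1) by simp
qed

lemma K2_hub_neighbours:
  assumes "v \<le> 1"
  shows "u \<in> K2_verts k \<and> K2_adj k v u \<longleftrightarrow> u \<in> {2..k+1}"
  using assms by (auto simp: K2_verts_def K2_adj_def)

lemma K2_leaf_neighbours:
  assumes "v \<in> {2..k+1}"
  shows "u \<in> K2_verts k \<and> K2_adj k v u \<longleftrightarrow> u \<in> {0, 1}"
  using assms by (auto simp: K2_verts_def K2_adj_def)

lemma K2_feedback_leaf:
  assumes "v \<in> {2..k+1}" "\<alpha> v = \<beta> 2" "\<alpha> 0 = \<beta> 0" "\<alpha> 1 = \<beta> 1"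
  shows "K2_feedback cd k \<alpha> v = K2_feedback cd 1 \<beta> 2"
proof (rule slot_feedback_cong)
  fix u
  have "2 \<in> {2..1 + 1 :: nat}" by simp
  thus "u \<in> K2_verts k \<and> K2_adj k v u \<longleftrightarrow> u \<in> K2_verts 1 \<and> K2_adj 1 2 u"
    unfolding K2_leaf_neighbours[OF assms(1)] by (simp add: K2_leaf_neighbours)
  show "\<alpha> u = \<beta> u" if "u \<in> K2_verts k" "K2_adj k v u"
    using that K2_leaf_neighbours[OF assms(1), of u] assms(3,4) by auto
qed (rule assms(2))

lemma K2_feedback_hub:
  assumes "v \<le> 1"
    and "\<alpha> v = Listen \<Longrightarrow> \<nexists>!u. u \<in> {2..k+1} \<and> is_transmit (\<alpha> u)"
    and "\<alpha> v = Listen \<Longrightarrow> noise \<longleftrightarrow> cd \<and> (\<exists>u\<in>{2..k+1}. is_transmit (\<alpha> u))"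
  shows "K2_feedback cd k \<alpha> v =
    (if \<alpha> v = Listen then if noise then Noise else Silence else NoFeedback)"
proof -
  have "u \<in> K2_verts k \<and> K2_adj k v u \<and> is_transmit (\<alpha> u) \<longleftrightarrow> u \<in> {2..k+1} \<and> is_transmit (\<alpha> u)" for u
    using K2_hub_neighbours[OF assms(1)] by blast
  thus ?thesis unfolding slot_feedback_def using assms(2,3) by (simp add: Bex_def)
qed

text \<open>A hub that never receives a message; \<open>N t\<close> says whether listening in slot \<open>t\<close> yields noise.\<close>
primrec hub_history ::
  "('l, 'msg) algorithm \<Rightarrow> (nat \<Rightarrow> bool) \<Rightarrow> 'l \<Rightarrow> nat \<Rightarrow> 'msg feedback list" where
  "hub_history act N a 0 = []"
| "hub_history act N a (Suc t) = hub_history act N a t @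
     [if act a (hub_history act N a t) = Listen then if N t then Noise else Silence else NoFeedback]"

text \<open>A leaf with local data \<open>x\<close> whose only neighbours are two such hubs, as vertex 2 of \<open>K\<^bsub>2,1\<^esub>\<close>.\<close>
primrec leaf_history ::
  "bool \<Rightarrow> ('l, 'msg) algorithm \<Rightarrow> (nat \<Rightarrow> bool) \<Rightarrow> 'l \<Rightarrow> 'l \<Rightarrow> 'l \<Rightarrow> nat \<Rightarrow> 'msg feedback list"
where
  "leaf_history cd act N a b x 0 = []"
| "leaf_history cd act N a b x (Suc t) = leaf_history cd act N a b x t @
     [K2_feedback cd 1
       ((\<lambda>_. act x (leaf_history cd act N a b x t))
         (0 := act a (hub_history act N a t), 1 := act b (hub_history act N b t))) 2]"

definition leaf_transmits ::
  "bool \<Rightarrow> ('l, 'msg) algorithm \<Rightarrow> (nat \<Rightarrow> bool) \<Rightarrow> 'l \<Rightarrow> 'l \<Rightarrow> 'l \<Rightarrow> nat \<Rightarrow> bool" where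
  "leaf_transmits cd act N a b x t \<longleftrightarrow> is_transmit (act x (leaf_history cd act N a b x t))"

definition hub_listening ::
  "('l, 'msg) algorithm \<Rightarrow> (nat \<Rightarrow> bool) \<Rightarrow> 'l \<Rightarrow> 'l \<Rightarrow> nat \<Rightarrow> nat set" where
  "hub_listening act N a b T =
     {t. t < T \<and> (act a (hub_history act N a t) = Listen \<or> act b (hub_history act N b t) = Listen)}"

lemma finite_hub_listening [simp]: "finite (hub_listening act N a b T)"
  by (simp add: hub_listening_def)

definition hubs_uninformed ::
  "bool \<Rightarrow> ('l, 'msg) algorithm \<Rightarrow> (nat \<Rightarrow> bool) \<Rightarrow> nat \<Rightarrow> (nat \<Rightarrow> 'l) \<Rightarrow> nat \<Rightarrow> bool" where
  "hubs_uninformed cd act N k l T \<longleftrightarrow> (\<forall>t\<in>hub_listening act N (l 0) (l 1) T.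
     (\<nexists>!v. v \<in> {2..k+1} \<and> leaf_transmits cd act N (l 0) (l 1) (l v) t) \<and>
     (N t \<longleftrightarrow> cd \<and> (\<exists>v\<in>{2..k+1}. leaf_transmits cd act N (l 0) (l 1) (l v) t)))"

lemma history_eq_hub_leaf_history:
  assumes uninformed: "hubs_uninformed cd act N k l T" and "t \<le> T"
  shows "(\<forall>v\<le>1. K2_history cd k l act t v = hub_history act N (l v) t) \<and>
    (\<forall>v\<in>{2..k+1}. K2_history cd k l act t v = leaf_history cd act N (l 0) (l 1) (l v) t)"
  using \<open>t \<le> T\<close>
proof (induction t)
  case (Suc t)
  define \<alpha> where "\<alpha> u = act (l u) (K2_history cd k l act t u)" for u
  have hub: "K2_history cd k l act t v = hub_history act N (l v) t" if "v \<le> 1" for v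
    using Suc that by simp
  have leaf: "K2_history cd k l act t v = leaf_history cd act N (l 0) (l 1) (l v) t"
    if "v \<in> {2..k+1}" for v using Suc that by simp
  have history_Suc: "K2_history cd k l act (Suc t) v = K2_history cd k l act t v @ [K2_feedback cd k \<alpha> v]" for v
    by (simp add: \<alpha>_def[abs_def] Let_def)
  have transmits: "u \<in> {2..k+1} \<and> is_transmit (\<alpha> u) \<longleftrightarrow>
      u \<in> {2..k+1} \<and> leaf_transmits cd act N (l 0) (l 1) (l u) t" for u
    using leaf[of u] by (auto simp: \<alpha>_def leaf_transmits_def)
  have listening: "t \<in> hub_listening act N (l 0) (l 1) T" if "v \<le> 1" "\<alpha> v = Listen" for v
    using that Suc.prems hub[OF that(1)] by (auto simp: hub_listening_def \<alpha>_def le_Suc_eq)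
  have hub_feedback: "K2_feedback cd k \<alpha> v =
      (if \<alpha> v = Listen then if N t then Noise else Silence else NoFeedback)" if "v \<le> 1" for v
  proof (rule K2_feedback_hub[OF that])
    assume "\<alpha> v = Listen"
    note uninformed[unfolded hubs_uninformed_def, rule_format, OF listening[OF that this]]
    thus "\<nexists>!u. u \<in> {2..k+1} \<and> is_transmit (\<alpha> u)"
      and "N t \<longleftrightarrow> cd \<and> (\<exists>u\<in>{2..k+1}. is_transmit (\<alpha> u))"
      unfolding Bex_def transmits by blast+
  qed
  have leaf_feedback: "K2_feedback cd k \<alpha> v = K2_feedback cd 1
      ((\<lambda>_. act (l v) (leaf_history cd act N (l 0) (l 1) (l v) t))
        (0 := act (l 0) (hub_history act N (l 0) t), 1 := act (l 1) (hub_history act N (l 1) t))) 2"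
    if "v \<in> {2..k+1}" for v
    by (intro K2_feedback_leaf that) (simp_all add: \<alpha>_def hub leaf[OF that])
  show ?case
  proof (intro conjI allI ballI impI)
    fix v :: nat assume "v \<le> 1"
    thus "K2_history cd k l act (Suc t) v = hub_history act N (l v) (Suc t)"
      unfolding history_Suc hub_feedback[OF \<open>v \<le> 1\<close>] by (simp add: hub \<alpha>_def)
  next
    fix v assume "v \<in> {2..k+1}"
    thus "K2_history cd k l act (Suc t) v = leaf_history cd act N (l 0) (l 1) (l v) (Suc t)"
      unfolding history_Suc leaf_feedback[OF \<open>v \<in> {2..k+1}\<close>] by (simp only: leaf leaf_history.simps)
  qed
qed simp

lemma broadcast_fails_if_hubs_uninformed:
  assumes "hubs_uninformed cd act N k l T" "outp (l 1) (hub_history act N (l 1) T) \<noteq> m"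
  shows "\<not> K2_broadcast_success cd k l act outp T m"
proof
  assume "K2_broadcast_success cd k l act outp T m"
  hence "outp (l 1) (K2_history cd k l act T 1) = m"
    by (simp add: broadcast_success_def K2_verts_def)
  thus False using history_eq_hub_leaf_history[OF assms(1) order_refl] assms(2) by simp
qed

lemma card_hub_listening_le:
  assumes uninformed: "hubs_uninformed cd act N k l S" and "T' \<le> Suc S" "T' \<le> T"
    and energy: "energy_within cd (K2_verts k) (K2_adj k) l act T E"
  shows "card (hub_listening act N (l 0) (l 1) T') \<le> 2 * E"
proof -
  define active where "active v = {t. t < T \<and> action_at cd (K2_verts k) (K2_adj k) l act t v \<noteq> Idle}" for v
  have "hub_listening act N (l 0) (l 1) T' \<subseteq> active 0 \<union> active 1"
  proof
    fix t assume t: "t \<in> hub_listening act N (l 0) (l 1) T'"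
    hence "t \<le> S" "t < T" using assms(2,3) by (auto simp: hub_listening_def)
    thus "t \<in> active 0 \<union> active 1"
      using t history_eq_hub_leaf_history[OF uninformed \<open>t \<le> S\<close>]
      by (auto simp: active_def hub_listening_def action_at_def)
  qed
  hence "card (hub_listening act N (l 0) (l 1) T') \<le> card (active 0 \<union> active 1)"
    by (intro card_mono) (auto simp: active_def)
  also have "\<dots> \<le> card (active 0) + card (active 1)" by (rule card_Un_le)
  also have "\<dots> \<le> E + E"
    using energy unfolding energy_within_def energy_of_def active_def
    by (intro add_mono) (auto simp: K2_verts_def)
  finally show ?thesis by simp
qed

lemma hubs_uninformed_if_leaves_agree:
  assumes "2 \<le> k"
    and "\<And>t v. t \<in> hub_listening act N (l 0) (l 1) T \<Longrightarrow> v \<in> {2..k+1} \<Longrightarrow>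
      leaf_transmits cd act N (l 0) (l 1) (l v) t \<longleftrightarrow> P t"
    and "\<And>t. t \<in> hub_listening act N (l 0) (l 1) T \<Longrightarrow> N t \<longleftrightarrow> cd \<and> P t"
  shows "hubs_uninformed cd act N k l T"
  unfolding hubs_uninformed_def
proof (intro ballI conjI)
  fix t assume t: "t \<in> hub_listening act N (l 0) (l 1) T"
  have leaves: "2 \<in> {2..k+1}" "3 \<in> {2..k+1}" using assms(1) by auto
  show "\<nexists>!v. v \<in> {2..k+1} \<and> leaf_transmits cd act N (l 0) (l 1) (l v) t"
  proof
    assume "\<exists>!v. v \<in> {2..k+1} \<and> leaf_transmits cd act N (l 0) (l 1) (l v) t"
    hence "2 = (3 :: nat)" using leaves assms(2)[OF t] by blast
    thus False by simp
  qed
  show "N t \<longleftrightarrow> cd \<and> (\<exists>v\<in>{2..k+1}. leaf_transmits cd act N (l 0) (l 1) (l v) t)"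
    using leaves assms(2,3)[OF t] by blast
qed

lemma ex1_nth_leaf_iff_length_filter:
  "(\<exists>!v. v \<in> {2..length xs + 1} \<and> P (xs ! (v - 2))) \<longleftrightarrow> length (filter P xs) = 1"
proof -
  define A where "A = {v. v \<in> {2..length xs + 1} \<and> P (xs ! (v - 2))}"
  have "A = (\<lambda>i. i + 2) ` {i. i < length xs \<and> P (xs ! i)}"
  proof (intro equalityI subsetI)
    fix v assume "v \<in> A"
    thus "v \<in> (\<lambda>i. i + 2) ` {i. i < length xs \<and> P (xs ! i)}"
      by (intro image_eqI[of _ _ "v - 2"]) (auto simp: A_def)
  qed (auto simp: A_def)
  hence "card A = length (filter P xs)"
    unfolding length_filter_conv_card by (simp add: card_image del: One_nat_def add_2_eq_Suc')
  moreover have "(\<exists>!v. v \<in> A) \<longleftrightarrow> card A = 1"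
    by (auto simp: card_1_singleton_iff)
  ultimately show ?thesis by (simp add: A_def)
qed

lemma hubs_uninformed_if_leaf_list:
  assumes leaf: "\<And>v. v \<in> {2..length xs + 1} \<Longrightarrow> l v = d (xs ! (v - 2))"
    and no_single: "\<And>t. t \<in> hub_listening act no_noise (l 0) (l 1) T \<Longrightarrow>
      length (filter (\<lambda>x. leaf_transmits False act no_noise (l 0) (l 1) (d x) t) xs) \<noteq> 1"
  shows "hubs_uninformed False act no_noise (length xs) l T"
proof -
  define transmits where "transmits t x = leaf_transmits False act no_noise (l 0) (l 1) (d x) t" for t x
  have leaves: "v \<in> {2..length xs + 1} \<and> leaf_transmits False act no_noise (l 0) (l 1) (l v) t \<longleftrightarrow>
      v \<in> {2..length xs + 1} \<and> transmits t (xs ! (v - 2))" for v t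
    using leaf[of v] by (auto simp: transmits_def)
  have "length (filter (transmits t) xs) \<noteq> 1" if "t \<in> hub_listening act no_noise (l 0) (l 1) T" for t
    using no_single[OF that] unfolding transmits_def .
  thus ?thesis unfolding hubs_uninformed_def leaves ex1_nth_leaf_iff_length_filter by simp
qed

section \<open>Deterministic algorithms\<close>

lemma exists_identifiers_hubs_uninformed:
  fixes act :: "(nat \<times> nat option, 'msg) algorithm"
  assumes "\<Delta> + 2 \<le> N" "card (hub_listening act no_noise (1, Some m) (2, None) T) < \<Delta>"
  obtains k id where "k \<in> {1..\<Delta>}" "inj_on id (K2_verts k)" "id ` K2_verts k \<subseteq> {1..N}" "id 0 = 1" "id 1 = 2"
    "hubs_uninformed False act no_noise k (\<lambda>v. (id v, src_in m v)) T"
proof -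
  define transmits where
    "transmits t x = leaf_transmits False act no_noise (1, Some m) (2, None) (x, None) t" for t x
  obtain G where subset: "G \<subseteq> {3..\<Delta>+2}" "G \<noteq> {}"
    and no_single: "\<forall>t\<in>hub_listening act no_noise (1, Some m) (2, None) T. \<nexists>!x. x \<in> G \<and> transmits t x"
    using exists_subset_without_singles[of "hub_listening act no_noise (1, Some m) (2, None) T"
      "{3..\<Delta>+2}" transmits] assms(2) by (auto simp del: One_nat_def)
  have "finite G" using subset(1) finite_subset by blast
  then obtain xs where xs: "set xs = G" "distinct xs" using finite_distinct_list by blast
  define id where "id v = (1 # 2 # xs) ! v" for v
  have verts: "K2_verts (length xs) = {..<length (1 # 2 # xs)}" by (auto simp: K2_verts_def)
  show ?thesis
  proof
    have "length xs \<le> card {3..\<Delta>+2}" using card_mono[OF _ subset(1)] distinct_card[OF xs(2)] xs(1) by simp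
    thus "length xs \<in> {1..\<Delta>}" using xs(1) subset(2) by (auto simp: Suc_le_eq)
    show "inj_on id (K2_verts (length xs))"
      unfolding verts id_def using xs subset(1) by (intro inj_on_nth) auto
    show "id ` K2_verts (length xs) \<subseteq> {1..N}"
      unfolding verts id_def using nth_image[of "length (1 # 2 # xs)" "1 # 2 # xs"] xs(1) subset(1) assms(1)
      by (auto simp: lessThan_atLeast0)
    have hubs: "(id 0, src_in m 0) = (1, Some m)" "(id 1, src_in m 1) = (2, None)"
      by (simp_all add: id_def src_in_def)
    show "hubs_uninformed False act no_noise (length xs) (\<lambda>v. (id v, src_in m v)) T"
    proof (rule hubs_uninformed_if_leaf_list[where d = "\<lambda>x. (x, None)"], unfold hubs)
      show "(id v, src_in m v) = (xs ! (v - 2), None)" if "v \<in> {2..length xs + 1}" for v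
        using that by (auto simp: id_def src_in_def nth_Cons' numeral_2_eq_2)
      fix t assume "t \<in> hub_listening act no_noise (1, Some m) (2, None) T"
      hence "\<nexists>!x. x \<in> set xs \<and> transmits t x" using no_single xs(1) by simp
      thus "length (filter (\<lambda>x. leaf_transmits False act no_noise (1, Some m) (2, None) (x, None) t) xs) \<noteq> 1"
        using ex1_if_length_filter_eq_1 unfolding transmits_def by blast
    qed
  qed (simp_all add: id_def)
qed

lemma deterministic_card_hub_listening_Suc_le:
  fixes act :: "(nat \<times> nat option, 'msg) algorithm"
  assumes "\<Delta> + 2 \<le> N" and energy: "det_K2_energy False N \<Delta> act T E" and "S < T"
    and few: "card (hub_listening act no_noise (1, Some m) (2, None) S) < \<Delta>"
  shows "card (hub_listening act no_noise (1, Some m) (2, None) (Suc S)) \<le> 2 * E"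
proof -
  obtain k id where id: "k \<in> {1..\<Delta>}" "inj_on id (K2_verts k)" "id ` K2_verts k \<subseteq> {1..N}" "id 0 = 1" "id 1 = 2"
    and uninformed: "hubs_uninformed False act no_noise k (\<lambda>v. (id v, src_in m v)) S"
    by (rule exists_identifiers_hubs_uninformed[OF assms(1) few])
  have "energy_within False (K2_verts k) (K2_adj k) (\<lambda>v. (id v, src_in m v)) act T E"
    using energy id(1-3) unfolding det_K2_energy_def by blast
  from card_hub_listening_le[OF uninformed order_refl Suc_leI[OF \<open>S < T\<close>] this]
  show ?thesis unfolding id(4,5) by (simp add: src_in_def)
qed

lemma deterministic_energy_ge:
  fixes act :: "(nat \<times> nat option, 'msg) algorithm"
  assumes "\<Delta> + 2 \<le> N"
    and correct: "det_K2_correct False N \<Delta> act outp T" and energy: "det_K2_energy False N \<Delta> act T E"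
  shows "\<Delta> \<le> 2 * E"
proof (rule ccontr)
  assume "\<not> \<Delta> \<le> 2 * E"
  hence "2 * E < \<Delta>" by simp
  define m where "m = Suc (outp (2, None) (hub_history act no_noise (2, None) T))"
  have "card (hub_listening act no_noise (1, Some m) (2, None) S) \<le> 2 * E" if "S \<le> T" for S
    using that
  proof (induction S)
    case 0
    thus ?case by (simp add: hub_listening_def)
  next
    case (Suc S)
    thus ?case using \<open>2 * E < \<Delta>\<close> by (intro deterministic_card_hub_listening_Suc_le[OF assms(1) energy]) auto
  qed
  hence few: "card (hub_listening act no_noise (1, Some m) (2, None) T) < \<Delta>"
    using \<open>2 * E < \<Delta>\<close> by (meson le_less_trans order_refl)
  obtain k id where id: "k \<in> {1..\<Delta>}" "inj_on id (K2_verts k)" "id ` K2_verts k \<subseteq> {1..N}" "id 0 = 1" "id 1 = 2"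
    and uninformed: "hubs_uninformed False act no_noise k (\<lambda>v. (id v, src_in m v)) T"
    by (rule exists_identifiers_hubs_uninformed[OF assms(1) few])
  have "\<not> K2_broadcast_success False k (\<lambda>v. (id v, src_in m v)) act outp T m"
    using id(5) by (intro broadcast_fails_if_hubs_uninformed[OF uninformed]) (simp add: m_def src_in_def)
  thus False using correct id(1-3) unfolding det_K2_correct_def by blast
qed

section \<open>Sampling the random bits\<close>

lemma prob_space_coin_space: "prob_space coin_space"
  unfolding coin_space_def by (intro prob_space_PiM measure_pmf.prob_space_axioms)

lemma space_coin_space [simp]: "space coin_space = UNIV"
  unfolding coin_space_def by (simp add: space_PiM)

lemma coin_space_reindex:
  assumes "inj g" and S: "S \<in> sets coin_space"
  shows "{\<omega>. \<omega> \<circ> g \<in> S} \<in> sets coin_space"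
    and "measure coin_space {\<omega>. \<omega> \<circ> g \<in> S} = measure coin_space S"
proof -
  define B :: "(nat \<Rightarrow> bool) measure" where "B = (\<Pi>\<^sub>M i\<in>UNIV. measure_pmf (pmf_of_set UNIV))"
  have coin: "coin_space = (\<Pi>\<^sub>M v\<in>UNIV. B)" by (simp add: coin_space_def B_def)
  have "prob_space B" unfolding B_def by (intro prob_space_PiM measure_pmf.prob_space_axioms)
  hence distr: "distr coin_space coin_space (\<lambda>\<omega>. \<omega> \<circ> g) = coin_space"
    using distr_PiM_reindex[of UNIV "\<lambda>_. B" g UNIV] assms(1) unfolding coin by (simp add: comp_def restrict_def)
  have meas: "(\<lambda>\<omega>. \<omega> \<circ> g) \<in> measurable coin_space coin_space"
    unfolding coin comp_def by (rule measurable_PiM_single') (auto simp: space_PiM)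
  show "{\<omega>. \<omega> \<circ> g \<in> S} \<in> sets coin_space"
    using measurable_sets[OF meas S] by (simp add: vimage_def)
  show "measure coin_space {\<omega>. \<omega> \<circ> g \<in> S} = measure coin_space S"
    using measure_distr[OF meas S] by (simp add: distr vimage_def)
qed

abbreviation population :: "nat \<Rightarrow> nat set" where
  "population M \<equiv> {2..<M+2}"

text \<open>The leaves receive the random bits of the vertices in \<open>xs\<close>. The unused vertices are shifted out of
  their way, which makes the relabelling injective.\<close>
definition relabel :: "nat \<Rightarrow> nat list \<Rightarrow> nat \<Rightarrow> nat" where
  "relabel M xs v = (if v < length xs + 2 then (0 # 1 # xs) ! v else v + M)"

lemma inj_relabel:
  assumes "distinct xs" "xs \<in> tuples (population M) k"
  shows "inj (relabel M xs)"
proof (rule injI)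
  fix v w assume eq: "relabel M xs v = relabel M xs w"
  have small: "(0 # 1 # xs) ! u < M + 2" if "u < length xs + 2" for u
    using assms(2) nth_mem[of u "0 # 1 # xs"] that by (auto simp: tuples_def)
  have "distinct (0 # 1 # xs)" using assms by (auto simp: tuples_def)
  thus "v = w"
    using eq small[of v] small[of w] nth_eq_iff_index_eq[of "0 # 1 # xs" v w]
    by (auto simp: relabel_def split: if_splits)
qed

definition sampled_input :: "nat \<Rightarrow> (nat \<Rightarrow> nat \<Rightarrow> bool) \<Rightarrow> nat list \<Rightarrow> nat \<Rightarrow> nat \<Rightarrow> (nat \<Rightarrow> bool) \<times> nat option" where
  "sampled_input M \<omega> xs m v = (\<omega> (relabel M xs v), src_in m v)"

lemma sampled_input_hub:
  "sampled_input M \<omega> xs m 0 = (\<omega> 0, Some m)"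
  "sampled_input M \<omega> xs m 1 = (\<omega> 1, None)"
  by (simp_all add: sampled_input_def relabel_def src_in_def)

lemma sampled_input_leaf:
  assumes "v \<in> {2..length xs + 1}"
  shows "sampled_input M \<omega> xs m v = (\<omega> (xs ! (v - 2)), None)"
  using assms by (auto simp: sampled_input_def relabel_def src_in_def nth_Cons' numeral_2_eq_2)

abbreviation sampled_listening ::
  "((nat \<Rightarrow> bool) \<times> nat option, 'msg) algorithm \<Rightarrow> (nat \<Rightarrow> bool) \<Rightarrow> (nat \<Rightarrow> nat \<Rightarrow> bool) \<Rightarrow> nat \<Rightarrow> nat \<Rightarrow> nat set" where
  "sampled_listening act N \<omega> m T \<equiv> hub_listening act N (\<omega> 0, Some m) (\<omega> 1, None) T"

abbreviation sampled_transmits ::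
  "bool \<Rightarrow> ((nat \<Rightarrow> bool) \<times> nat option, 'msg) algorithm \<Rightarrow> (nat \<Rightarrow> bool) \<Rightarrow> (nat \<Rightarrow> nat \<Rightarrow> bool)
   \<Rightarrow> nat \<Rightarrow> nat \<Rightarrow> nat \<Rightarrow> bool" where
  "sampled_transmits cd act N \<omega> m t x \<equiv> leaf_transmits cd act N (\<omega> 0, Some m) (\<omega> 1, None) (\<omega> x, None) t"

text \<open>Tuples with repetitions do not stand for independent leaves, but make up at most a fraction
  \<open>k\<^sup>2 / M\<close> of all tuples.\<close>
definition failure_rate ::
  "bool \<Rightarrow> ((nat \<Rightarrow> bool) \<times> nat option, 'msg) algorithm
   \<Rightarrow> ((nat \<Rightarrow> bool) \<times> nat option \<Rightarrow> 'msg feedback list \<Rightarrow> nat) \<Rightarrow> nat \<Rightarrow> nat \<Rightarrow> (nat \<Rightarrow> nat \<Rightarrow> bool)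
   \<Rightarrow> nat \<Rightarrow> nat \<Rightarrow> real" where
  "failure_rate cd act outp T M \<omega> k m = real (card {xs \<in> tuples (population M) k.
     \<not> K2_broadcast_success cd k (sampled_input M \<omega> xs m) act outp T m}) / real M ^ k"

lemma failure_rate_nonneg: "0 \<le> failure_rate cd act outp T M \<omega> k m"
  by (simp add: failure_rate_def)

lemma rand_K2_whp_failure_event:
  assumes "rand_K2_whp cd n c \<Delta> act outp T" "k \<in> {1..\<Delta>}" "xs \<in> tuples (population M) k"
  shows "\<exists>A. A \<in> sets coin_space \<and>
    {\<omega>. \<not> K2_broadcast_success cd k (sampled_input M \<omega> xs m) act outp T m} \<subseteq> A \<and>
    measure coin_space A \<le> 1 / real n powr c + of_bool (\<not> distinct xs)"
proof (cases "distinct xs")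
  case True
  interpret prob_space coin_space by (rule prob_space_coin_space)
  obtain S where S_event: "S \<in> sets coin_space" "measure coin_space S \<ge> 1 - 1 / real n powr c"
    and success: "\<And>\<omega>. \<omega> \<in> S \<Longrightarrow> K2_broadcast_success cd k (\<lambda>v. (\<omega> v, src_in m v)) act outp T m"
    using assms(1)[unfolded rand_K2_whp_def, rule_format, OF assms(2), of m] by blast
  define A where "A = {\<omega>. \<omega> \<circ> relabel M xs \<in> S}"
  have A_event: "A \<in> sets coin_space" "measure coin_space A = measure coin_space S"
    unfolding A_def using coin_space_reindex[OF inj_relabel[OF True assms(3)] S_event(1)] by auto
  have "K2_broadcast_success cd k (sampled_input M \<omega> xs m) act outp T m" if "\<omega> \<in> A" for \<omega>
    using success[of "\<omega> \<circ> relabel M xs"] that by (simp add: A_def sampled_input_def[abs_def])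
  thus ?thesis
    using A_event S_event(2) prob_compl[OF A_event(1)] sets.compl_sets[OF A_event(1)] True
    by (intro exI[of _ "UNIV - A"]) auto
next
  case False
  interpret prob_space coin_space by (rule prob_space_coin_space)
  show ?thesis using False prob_space sets.top[of coin_space] by (intro exI[of _ UNIV]) auto
qed

lemma failure_rate_majorant:
  assumes whp: "rand_K2_whp cd n c \<Delta> act outp T" and range: "k \<in> {1..\<Delta>}" and "0 < M"
  shows "\<exists>R. integrable coin_space R \<and> (\<forall>\<omega>. failure_rate cd act outp T M \<omega> k m \<le> R \<omega>) \<and>
    integral\<^sup>L coin_space R \<le> 1 / real n powr c + (real k)\<^sup>2 / real M"
proof -
  interpret prob_space coin_space by (rule prob_space_coin_space)
  define fails where "fails xs = {\<omega>. \<not> K2_broadcast_success cd k (sampled_input M \<omega> xs m) act outp T m}" for xs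
  define \<delta> where "\<delta> = 1 / real n powr c"
  have "\<forall>xs\<in>tuples (population M) k. \<exists>A. A \<in> events \<and> fails xs \<subseteq> A \<and> prob A \<le> \<delta> + of_bool (\<not> distinct xs)"
    unfolding fails_def \<delta>_def by (intro ballI rand_K2_whp_failure_event[OF whp range])
  then obtain A where cover: "\<forall>xs\<in>tuples (population M) k. A xs \<in> events \<and> fails xs \<subseteq> A xs \<and>
      prob (A xs) \<le> \<delta> + of_bool (\<not> distinct xs)"
    unfolding bchoice_iff by (rule exE)
  define R :: "(nat \<Rightarrow> nat \<Rightarrow> bool) \<Rightarrow> real" where
    "R \<omega> = (\<Sum>xs\<in>tuples (population M) k. indicator (A xs) \<omega>) / real M ^ k" for \<omega>
  have integrable: "integrable coin_space (indicat_real (A xs))" if "xs \<in> tuples (population M) k" for xs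
    using cover that by (intro integrable_real_indicator) (auto simp: emeasure_eq_measure)
  have "failure_rate cd act outp T M \<omega> k m \<le> R \<omega>" for \<omega>
  proof -
    have "failure_rate cd act outp T M \<omega> k m = (\<Sum>xs\<in>tuples (population M) k. indicator (fails xs) \<omega>) / real M ^ k"
      by (simp add: failure_rate_def fails_def indicator_def sum.If_cases Int_def)
    also have "\<dots> \<le> R \<omega>"
      unfolding R_def using cover by (intro divide_right_mono sum_mono) (auto simp: indicator_def)
    finally show ?thesis .
  qed
  moreover have "expectation R \<le> \<delta> + (real k)\<^sup>2 / real M"
  proof -
    have "expectation R = (\<Sum>xs\<in>tuples (population M) k. prob (A xs)) / real M ^ k"
      unfolding R_def using integrable cover by (simp add: Bochner_Integration.integral_sum)
    also have "\<dots> \<le> (\<Sum>xs\<in>tuples (population M) k. \<delta> + of_bool (\<not> distinct xs)) / real M ^ k"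
      using cover by (intro divide_right_mono sum_mono) auto
    also have "\<dots> = \<delta> + real (card {xs \<in> tuples (population M) k. \<not> distinct xs}) / real M ^ k"
      using \<open>0 < M\<close> by (simp add: sum.distrib card_tuples add_divide_distrib Int_def)
    also have "real (card {xs \<in> tuples (population M) k. \<not> distinct xs}) / real M ^ k \<le> (real k)\<^sup>2 / real M"
      using card_not_distinct_tuples_le[of "population M" k] \<open>0 < M\<close>
      by (simp add: field_simps flip: of_nat_mult of_nat_power)
    finally show ?thesis by simp
  qed
  moreover have "integrable coin_space R"
    unfolding R_def[abs_def] using integrable by (intro integrable_divide Bochner_Integration.integrable_sum)
  ultimately show ?thesis unfolding \<delta>_def by blast
qed

text \<open>Fixing one outcome for all random bits leaves only finite counting, so that no measurability of the
  algorithm is needed.\<close>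
lemma exists_coins_failure_rate_le:
  assumes whp: "rand_K2_whp cd n c \<Delta> act outp T" and range: "\<And>i. i \<in> J \<Longrightarrow> k i \<in> {1..\<Delta>}" and "0 < M"
  shows "\<exists>\<omega>. (\<Sum>i\<in>J. failure_rate cd act outp T M \<omega> (k i) (m i))
    \<le> real (card J) * (1 / real n powr c + (real \<Delta>)\<^sup>2 / real M)"
proof -
  interpret prob_space coin_space by (rule prob_space_coin_space)
  have "\<forall>i\<in>J. \<exists>R. integrable coin_space R \<and> (\<forall>\<omega>. failure_rate cd act outp T M \<omega> (k i) (m i) \<le> R \<omega>) \<and>
      expectation R \<le> 1 / real n powr c + (real (k i))\<^sup>2 / real M"
    using range by (intro ballI failure_rate_majorant[OF whp _ \<open>0 < M\<close>])
  then obtain R where majorant: "\<And>i. i \<in> J \<Longrightarrow> integrable coin_space (R i)"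
      "\<And>i \<omega>. i \<in> J \<Longrightarrow> failure_rate cd act outp T M \<omega> (k i) (m i) \<le> R i \<omega>"
      "\<And>i. i \<in> J \<Longrightarrow> expectation (R i) \<le> 1 / real n powr c + (real (k i))\<^sup>2 / real M"
    unfolding bchoice_iff by blast
  obtain \<omega> where below_mean: "(\<Sum>i\<in>J. R i \<omega>) \<le> expectation (\<lambda>\<omega>. \<Sum>i\<in>J. R i \<omega>)"
    using exists_le_expectation[of "\<lambda>\<omega>. \<Sum>i\<in>J. R i \<omega>"] majorant(1) by auto
  have "(\<Sum>i\<in>J. failure_rate cd act outp T M \<omega> (k i) (m i)) \<le> (\<Sum>i\<in>J. R i \<omega>)"
    using majorant(2) by (rule sum_mono)
  also note below_mean
  also have "expectation (\<lambda>\<omega>. \<Sum>i\<in>J. R i \<omega>) = (\<Sum>i\<in>J. expectation (R i))"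
    using majorant(1) by (rule Bochner_Integration.integral_sum)
  also have "\<dots> \<le> (\<Sum>i\<in>J. 1 / real n powr c + (real \<Delta>)\<^sup>2 / real M)"
  proof (rule sum_mono)
    fix i assume "i \<in> J"
    hence "(real (k i))\<^sup>2 / real M \<le> (real \<Delta>)\<^sup>2 / real M"
      using range[of i] by (intro divide_right_mono power_mono) auto
    thus "expectation (R i) \<le> 1 / real n powr c + (real \<Delta>)\<^sup>2 / real M" using majorant(3)[OF \<open>i \<in> J\<close>] by linarith
  qed
  finally show ?thesis by (auto intro: exI[of _ \<omega>])
qed

lemma failure_rate_ge:
  assumes "S \<subseteq> tuples (population M) k"
    and "\<And>xs. xs \<in> S \<Longrightarrow> hubs_uninformed cd act N k (sampled_input M \<omega> xs m) T"
    and "outp (\<omega> 1, None) (hub_history act N (\<omega> 1, None) T) \<noteq> m"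
  shows "real (card S) / real M ^ k \<le> failure_rate cd act outp T M \<omega> k m"
proof -
  have "\<not> K2_broadcast_success cd k (sampled_input M \<omega> xs m) act outp T m" if "xs \<in> S" for xs
    using assms(3)
    by (intro broadcast_fails_if_hubs_uninformed[OF assms(2)[OF that]]) (simp only: sampled_input_hub simp_thms)
  hence "S \<subseteq> {xs \<in> tuples (population M) k.
      \<not> K2_broadcast_success cd k (sampled_input M \<omega> xs m) act outp T m}"
    using assms(1) by blast
  thus ?thesis unfolding failure_rate_def by (intro divide_right_mono) (simp_all add: card_mono)
qed

lemma card_sampled_listening_le:
  assumes "rand_K2_energy cd \<Delta> act T E" "2 \<le> \<Delta>"
    and agree: "\<And>t. t \<in> sampled_listening act N \<omega> m T \<Longrightarrow> N t \<longleftrightarrow> cd \<and> sampled_transmits cd act N \<omega> m t x"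
  shows "card (sampled_listening act N \<omega> m T) \<le> 2 * E"
proof -
  define l where "l v = (if v < 2 then \<omega> v else \<omega> x, src_in m v)" for v
  have data: "l 0 = (\<omega> 0, Some m)" "l 1 = (\<omega> 1, None)" "v \<in> {2..2+1} \<Longrightarrow> l v = (\<omega> x, None)" for v
    by (auto simp: l_def src_in_def)
  have "hubs_uninformed cd act N 2 l T"
    by (rule hubs_uninformed_if_leaves_agree[OF order_refl, where P = "\<lambda>t. sampled_transmits cd act N \<omega> m t x"])
      (use agree in \<open>simp_all add: data del: One_nat_def\<close>)
  moreover have "energy_within cd (K2_verts 2) (K2_adj 2) l act T E"
    using assms(1,2) unfolding rand_K2_energy_def l_def[abs_def] by auto
  ultimately show ?thesis
    using card_hub_listening_le[of cd act N 2 l T T T E] by (simp add: data del: One_nat_def)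
qed

section \<open>Collision detection\<close>

lemma hub_history_cong:
  assumes "\<And>s. s < t \<Longrightarrow> N s = N' s"
  shows "hub_history act N a t = hub_history act N' a t"
  using assms by (induction t) auto

lemma leaf_history_cong:
  assumes "\<And>s. s < t \<Longrightarrow> N s = N' s"
  shows "leaf_history cd act N a b x t = leaf_history cd act N' a b x t"
  using assms
proof (induction t)
  case (Suc t)
  hence "leaf_history cd act N a b x t = leaf_history cd act N' a b x t"
    "hub_history act N l t = hub_history act N' l t" for l
    by (auto intro: hub_history_cong)
  thus ?case by simp
qed simp

lemma exists_indistinguishable_leaves:
  assumes "finite P"
  shows "\<exists>N. \<exists>A\<subseteq>P. card P \<le> card A * 2 ^ card (hub_listening act N a b T) \<and>
    (\<forall>t\<in>hub_listening act N a b T. \<forall>x\<in>A. leaf_transmits cd act N a b (X x) t = N t)"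
  unfolding hub_listening_def
proof (rule exists_majority_pattern[OF assms,
    where F = "\<lambda>N t x. leaf_transmits cd act N a b (X x) t"], intro conjI)
  fix N N' :: "nat \<Rightarrow> bool" and t assume "\<And>s. s < t \<Longrightarrow> N s = N' s"
  note hub = hub_history_cong[of t N N', OF this] and leaf = leaf_history_cong[of t N N', OF this]
  show "(act a (hub_history act N a t) = Listen \<or> act b (hub_history act N b t) = Listen) =
      (act a (hub_history act N' a t) = Listen \<or> act b (hub_history act N' b t) = Listen)"
    by (simp add: hub)
  show "(\<lambda>x. leaf_transmits cd act N a b (X x) t) = (\<lambda>x. leaf_transmits cd act N' a b (X x) t)"
    by (simp add: leaf_transmits_def leaf)
qed

lemma card_hub_histories_le:
  "finite (range (\<lambda>N. hub_history act N a T))" "card (range (\<lambda>N. hub_history act N a T)) \<le> 2 ^ T"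
proof -
  have "hub_history act N a T = hub_history act (restrict N {..<T}) a T" for N
    by (intro hub_history_cong) simp
  hence "range (\<lambda>N. hub_history act N a T) = (\<lambda>N. hub_history act N a T) ` ({..<T} \<rightarrow>\<^sub>E UNIV)"
    by (force intro!: image_eqI[where x = "restrict _ {..<T}"])
  moreover have "finite ({..<T} \<rightarrow>\<^sub>E (UNIV :: bool set))" "card ({..<T} \<rightarrow>\<^sub>E (UNIV :: bool set)) = 2 ^ T"
    by (simp_all add: finite_PiE card_PiE)
  ultimately show "finite (range (\<lambda>N. hub_history act N a T))" "card (range (\<lambda>N. hub_history act N a T)) \<le> 2 ^ T"
    by (metis finite_imageI, metis card_image_le)
qed

lemma cd_failure_rate_ge:
  assumes energy: "rand_K2_energy True \<Delta> act T E" "2 \<le> \<Delta>" and "0 < M"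
    and unheard: "\<And>N. outp (\<omega> 1, None) (hub_history act N (\<omega> 1, None) T) \<noteq> m"
  shows "1 / 2 ^ (4 * E) \<le> failure_rate True act outp T M \<omega> 2 m"
proof -
  let ?listening = "\<lambda>N. sampled_listening act N \<omega> m T"
  obtain N A where subset: "A \<subseteq> population M" and card: "M \<le> card A * 2 ^ card (?listening N)"
    and agree: "\<And>t x. t \<in> ?listening N \<Longrightarrow> x \<in> A \<Longrightarrow> sampled_transmits True act N \<omega> m t x = N t"
    using exists_indistinguishable_leaves[of "population M" act "(\<omega> 0, Some m)" "(\<omega> 1, None)" T True
      "\<lambda>x. (\<omega> x, None)"] by auto
  have "finite A" using subset finite_subset by blast
  have "A \<noteq> {}" using card \<open>0 < M\<close> by auto
  then obtain x where "x \<in> A" by blast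
  have "card (?listening N) \<le> 2 * E"
    by (rule card_sampled_listening_le[OF energy, of _ _ _ x]) (simp only: agree \<open>x \<in> A\<close> simp_thms)
  hence "card A * 2 ^ card (?listening N) \<le> card A * 2 ^ (2 * E)" by (intro mult_le_mono2 power_increasing) auto
  hence "M \<le> card A * 2 ^ (2 * E)" using card by linarith
  hence "M\<^sup>2 \<le> (card A * 2 ^ (2 * E))\<^sup>2" by (rule power_mono) simp
  hence "real (M\<^sup>2) \<le> real ((card A * 2 ^ (2 * E))\<^sup>2)" by (simp only: of_nat_le_iff)
  hence "1 / 2 ^ (4 * E) \<le> real (card A ^ 2) / real M ^ 2"
    using \<open>0 < M\<close> by (simp add: field_simps power_mult_distrib flip: power_mult)
  also have "card A ^ 2 = card (tuples A 2)" using \<open>finite A\<close> by (simp add: card_tuples)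
  also have "real \<dots> / real M ^ 2 \<le> failure_rate True act outp T M \<omega> 2 m"
  proof (rule failure_rate_ge)
    show "tuples A 2 \<subseteq> tuples (population M) 2" using subset by (auto simp: tuples_def)
    show "outp (\<omega> 1, None) (hub_history act N (\<omega> 1, None) T) \<noteq> m" by (rule unheard)
    fix xs assume "xs \<in> tuples A 2"
    hence xs: "set xs \<subseteq> A" "length xs = 2" by (auto simp: tuples_def)
    hence "xs ! (v - 2) \<in> A" if "v \<in> {2..2+1}" for v
      using that nth_mem[of "v - 2" xs] by auto
    thus "hubs_uninformed True act N 2 (sampled_input M \<omega> xs m) T"
      using xs by (intro hubs_uninformed_if_leaves_agree[where P = N])
        (simp_all add: sampled_input_hub sampled_input_leaf agree del: One_nat_def)
  qed
  finally show ?thesis .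
qed

lemma cd_failure_rate_sum_ge:
  assumes "rand_K2_energy True \<Delta> act T E" "2 \<le> \<Delta>" "0 < M"
  shows "(real Q - 2 ^ T) / 2 ^ (4 * E) \<le> (\<Sum>m<Q. failure_rate True act outp T M \<omega> 2 m)"
proof -
  define heard where "heard = outp (\<omega> 1, None) ` range (\<lambda>N. hub_history act N (\<omega> 1, None) T)"
  have finite: "finite heard" and "card heard \<le> 2 ^ T"
    unfolding heard_def using card_hub_histories_le[of act "(\<omega> 1, None)" T]
    by (auto intro: order_trans[OF card_image_le])
  hence "real (card heard) \<le> 2 ^ T" by (metis of_nat_le_iff of_nat_numeral of_nat_power)
  moreover have "Q - card heard \<le> card ({..<Q} - heard)"
    using diff_card_le_card_Diff[OF finite, of "{..<Q}"] by simp
  ultimately have "real Q - 2 ^ T \<le> real (card ({..<Q} - heard))" by linarith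
  hence "(real Q - 2 ^ T) / 2 ^ (4 * E) \<le> (\<Sum>m\<in>{..<Q} - heard. 1 / 2 ^ (4 * E))"
    by (simp add: divide_right_mono)
  also have "\<dots> \<le> (\<Sum>m\<in>{..<Q} - heard. failure_rate True act outp T M \<omega> 2 m)"
    using assms by (intro sum_mono cd_failure_rate_ge) (auto simp: heard_def)
  also have "\<dots> \<le> (\<Sum>m<Q. failure_rate True act outp T M \<omega> 2 m)"
    by (intro sum_mono2) (auto simp: failure_rate_nonneg)
  finally show ?thesis .
qed

lemma cd_failure_probability_ge:
  fixes act :: "((nat \<Rightarrow> bool) \<times> nat option, 'msg) algorithm"
  assumes "2 \<le> \<Delta>" and whp: "rand_K2_whp True n c \<Delta> act outp T" and energy: "rand_K2_energy True \<Delta> act T E"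
  shows "1 / 2 ^ (4 * E) \<le> 1 / real n powr c"
proof (rule le_if_le_add_divide_nat)
  fix M :: nat assume "0 < M"
  define Q where "Q = M * 2 ^ T"
  have "0 < Q" using \<open>0 < M\<close> by (simp add: Q_def)
  obtain \<omega> where "(\<Sum>m<Q. failure_rate True act outp T M \<omega> 2 m)
      \<le> real (card {..<Q}) * (1 / real n powr c + (real \<Delta>)\<^sup>2 / real M)"
    using exists_coins_failure_rate_le[OF whp _ \<open>0 < M\<close>, of "{..<Q}" "\<lambda>_. 2" "\<lambda>m. m"] \<open>2 \<le> \<Delta>\<close> by auto
  hence upper: "(\<Sum>m<Q. failure_rate True act outp T M \<omega> 2 m)
      \<le> real Q * (1 / real n powr c + (real \<Delta>)\<^sup>2 / real M)" by simp
  have "real Q * ((1 - 1 / real M) / 2 ^ (4 * E)) = (real Q - 2 ^ T) / 2 ^ (4 * E)"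
    using \<open>0 < M\<close> by (simp add: Q_def field_simps)
  also have "\<dots> \<le> (\<Sum>m<Q. failure_rate True act outp T M \<omega> 2 m)"
    by (rule cd_failure_rate_sum_ge[OF energy \<open>2 \<le> \<Delta>\<close> \<open>0 < M\<close>])
  also note upper
  finally have "(1 - 1 / real M) / 2 ^ (4 * E) \<le> 1 / real n powr c + (real \<Delta>)\<^sup>2 / real M"
    by (rule mult_left_le_imp_le) (simp add: \<open>0 < Q\<close>)
  thus "1 / 2 ^ (4 * E) \<le> 1 / real n powr c + ((real \<Delta>)\<^sup>2 + 1 / 2 ^ (4 * E)) / real M"
    by (simp add: diff_divide_distrib add_divide_distrib mult.commute)
qed

lemma cd_energy_ge:
  fixes act :: "((nat \<Rightarrow> bool) \<times> nat option, 'msg) algorithm"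
  assumes "1 \<le> c" "2 \<le> \<Delta>" "\<Delta> + 2 \<le> n"
    and "rand_K2_whp True n c \<Delta> act outp T" "rand_K2_energy True \<Delta> act T E"
  shows "1 / 4 * ln (real n) \<le> real E"
proof -
  have "1 / 2 ^ (4 * E) \<le> 1 / real n powr c" by (rule cd_failure_probability_ge[OF assms(2,4,5)])
  also have "\<dots> \<le> 1 / real n" using assms(1-3) by (intro one_div_powr_le_one_div) auto
  finally have "real n \<le> 2 ^ (4 * E)" using assms(2,3) by (simp add: field_simps)
  hence "ln (real n) \<le> ln (2 ^ (4 * E))" using assms(2,3) by simp
  also have "\<dots> = real (4 * E) * ln 2" by (rule ln_realpow)
  also have "\<dots> \<le> real (4 * E) * 1" using ln_le_minus_one[of "2 :: real"] by (intro mult_left_mono) auto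
  finally show ?thesis by simp
qed

section \<open>No collision detection\<close>

lemma hubs_uninformed_append:
  assumes "\<And>t. t \<in> sampled_listening act no_noise \<omega> m T \<Longrightarrow>
    (\<exists>x\<in>set xs. sampled_transmits False act no_noise \<omega> m t x) \<longleftrightarrow>
    (\<exists>y\<in>set ys. sampled_transmits False act no_noise \<omega> m t y)"
  shows "hubs_uninformed False act no_noise (length (xs @ ys)) (sampled_input M \<omega> (xs @ ys) m) T"
proof (rule hubs_uninformed_if_leaf_list, unfold sampled_input_hub)
  show "sampled_input M \<omega> (xs @ ys) m v = (\<omega> ((xs @ ys) ! (v - 2)), None)"
    if "v \<in> {2..length (xs @ ys) + 1}" for v using that by (rule sampled_input_leaf)
  show "length (filter (sampled_transmits False act no_noise \<omega> m t) (xs @ ys)) \<noteq> 1"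
    if "t \<in> sampled_listening act no_noise \<omega> m T" for t
    using assms[OF that] by (rule length_filter_append_neq_1)
qed

definition silence_frequency ::
  "((nat \<Rightarrow> bool) \<times> nat option, 'msg) algorithm \<Rightarrow> nat \<Rightarrow> (nat \<Rightarrow> nat \<Rightarrow> bool) \<Rightarrow> nat \<Rightarrow> nat \<Rightarrow> real"
where
  "silence_frequency act M \<omega> m t =
     relative_frequency (population M) (sampled_transmits False act no_noise \<omega> m t) False"

lemma no_cd_failure_rate_ge:
  fixes act :: "((nat \<Rightarrow> bool) \<times> nat option, 'msg) algorithm"
  assumes "0 < M" and unheard: "outp (\<omega> 1, None) (hub_history act no_noise (\<omega> 1, None) T) \<noteq> m"
  shows "exp (- (\<Sum>t\<in>sampled_listening act no_noise \<omega> m T.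
      binary_entropy (silence_frequency act M \<omega> m t ^ K))) \<le> failure_rate False act outp T M \<omega> (2 * K) m"
proof -
  define L where "L = sampled_listening act no_noise \<omega> m T"
  define U where "U xs = {t \<in> L. \<exists>x\<in>set xs. sampled_transmits False act no_noise \<omega> m t x}" for xs
  define C where "C = collisions (tuples (population M) K) U"
  have "relative_frequency (tuples (population M) K) (\<lambda>xs. t \<in> U xs) False =
      silence_frequency act M \<omega> m t ^ K" if "t \<in> L" for t
    using that relative_frequency_tuples[of "population M" K "sampled_transmits False act no_noise \<omega> m t"]
    by (simp add: U_def silence_frequency_def)
  moreover have "tuples (population M) K \<noteq> {}" using \<open>0 < M\<close> card_tuples[of "population M" K] by auto
  ultimately have "(real M ^ K)\<^sup>2 * exp (- (\<Sum>t\<in>L. binary_entropy (silence_frequency act M \<omega> m t ^ K)))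
      \<le> real (card C)"
    using card_collisions_ge_exp_entropy[of "tuples (population M) K" L U]
    by (simp add: C_def U_def L_def card_tuples)
  also have "card C = card ((\<lambda>(xs, ys). xs @ ys) ` C)"
    by (subst card_image) (auto simp: inj_on_def C_def collisions_def tuples_def)
  finally have "exp (- (\<Sum>t\<in>L. binary_entropy (silence_frequency act M \<omega> m t ^ K)))
      \<le> real (card ((\<lambda>(xs, ys). xs @ ys) ` C)) / real M ^ (2 * K)"
    using \<open>0 < M\<close> by (simp add: field_simps power_mult)
  also have "\<dots> \<le> failure_rate False act outp T M \<omega> (2 * K) m"
  proof (rule failure_rate_ge)
    show "outp (\<omega> 1, None) (hub_history act no_noise (\<omega> 1, None) T) \<noteq> m" by (rule unheard)
    show "(\<lambda>(xs, ys). xs @ ys) ` C \<subseteq> tuples (population M) (2 * K)"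
      by (fastforce simp: C_def collisions_def tuples_def)
    fix zs assume "zs \<in> (\<lambda>(xs, ys). xs @ ys) ` C"
    then obtain xs ys where zs: "zs = xs @ ys" and len: "length xs + length ys = 2 * K" and same: "U xs = U ys"
      by (auto simp: C_def collisions_def tuples_def)
    have "(\<exists>x\<in>set xs. sampled_transmits False act no_noise \<omega> m t x) \<longleftrightarrow>
        (\<exists>y\<in>set ys. sampled_transmits False act no_noise \<omega> m t y)" if "t \<in> L" for t
      using that same unfolding U_def by blast
    hence "hubs_uninformed False act no_noise (length (xs @ ys)) (sampled_input M \<omega> (xs @ ys) m) T"
      unfolding L_def by (rule hubs_uninformed_append)
    thus "hubs_uninformed False act no_noise (2 * K) (sampled_input M \<omega> zs m) T"
      using len by (simp add: zs)
  qed
  finally show ?thesis unfolding L_def .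
qed

lemma no_cd_sum_failure_rate_ge:
  fixes act :: "((nat \<Rightarrow> bool) \<times> nat option, 'msg) algorithm"
  assumes energy: "rand_K2_energy False \<Delta> act T E" "2 \<le> \<Delta>" and "0 < M" "1 \<le> I"
    and unheard: "outp (\<omega> 1, None) (hub_history act no_noise (\<omega> 1, None) T) \<noteq> m"
  shows "real I * exp (- (20 * real E / real I)) \<le> (\<Sum>i<I. failure_rate False act outp T M \<omega> (2 * 2 ^ i) m)"
proof -
  define L where "L = sampled_listening act no_noise \<omega> m T"
  define H where "H i = (\<Sum>t\<in>L. binary_entropy (silence_frequency act M \<omega> m t ^ 2 ^ i))" for i :: nat
  have "card L \<le> 2 * E"
    unfolding L_def by (rule card_sampled_listening_le[OF energy]) simp
  have "(\<Sum>i<I. H i) = (\<Sum>t\<in>L. \<Sum>i<I. binary_entropy (silence_frequency act M \<omega> m t ^ 2 ^ i))"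
    unfolding H_def by (rule sum.swap)
  also have "\<dots> \<le> (\<Sum>t\<in>L. 10)"
    unfolding silence_frequency_def
    by (intro sum_mono sum_binary_entropy_dyadic_le relative_frequency_nonneg relative_frequency_le_1) simp
  also have "\<dots> \<le> 20 * real E" using \<open>card L \<le> 2 * E\<close> by simp
  finally have "- (20 * real E / real I) \<le> (\<Sum>i<I. - H i) / real (card {..<I})"
    by (simp add: sum_negf divide_right_mono)
  hence "exp (- (20 * real E / real I)) \<le> exp ((\<Sum>i<I. - H i) / real (card {..<I}))" by simp
  also have "\<dots> \<le> (\<Sum>i<I. exp (- H i)) / real (card {..<I})"
    using \<open>1 \<le> I\<close> by (intro exp_mean_le_mean_exp) (auto simp: lessThan_empty_iff)
  finally have "real I * exp (- (20 * real E / real I)) \<le> (\<Sum>i<I. exp (- H i))"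
    using \<open>1 \<le> I\<close> by (simp add: field_simps)
  also have "\<dots> \<le> (\<Sum>i<I. failure_rate False act outp T M \<omega> (2 * 2 ^ i) m)"
    unfolding H_def L_def using \<open>0 < M\<close> unheard by (intro sum_mono no_cd_failure_rate_ge)
  finally show ?thesis .
qed

lemma no_cd_failure_probability_ge:
  fixes act :: "((nat \<Rightarrow> bool) \<times> nat option, 'msg) algorithm"
  assumes "1 \<le> I" "2 ^ I \<le> \<Delta>"
    and whp: "rand_K2_whp False n c \<Delta> act outp T" and energy: "rand_K2_energy False \<Delta> act T E"
  shows "exp (- (20 * real E / real I)) \<le> 2 / real n powr c"
proof (rule le_if_le_add_divide_nat)
  fix M :: nat assume "0 < M"
  have range: "2 * 2 ^ i \<in> {1..\<Delta>}" if "i < I" for i :: nat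
    using power_increasing[of "Suc i" I "2 :: nat"] that assms(2) by simp
  have "2 \<le> \<Delta>" using range[of 0] \<open>1 \<le> I\<close> by simp
  obtain \<omega> where average: "(\<Sum>p\<in>{..<I} \<times> {..<2}. failure_rate False act outp T M \<omega> (2 * 2 ^ fst p) (snd p))
      \<le> real (card ({..<I} \<times> {..<2 :: nat})) * (1 / real n powr c + (real \<Delta>)\<^sup>2 / real M)"
    using exists_coins_failure_rate_le[OF whp _ \<open>0 < M\<close>, of "{..<I} \<times> {..<2}" "\<lambda>p. 2 * 2 ^ fst p" snd] range
    by auto
  define m :: nat where
    "m = (if outp (\<omega> 1, None) (hub_history act no_noise (\<omega> 1, None) T) = 0 then 1 else 0)"
  have "real I * exp (- (20 * real E / real I)) \<le> (\<Sum>i<I. failure_rate False act outp T M \<omega> (2 * 2 ^ i) m)"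
    by (rule no_cd_sum_failure_rate_ge[OF energy \<open>2 \<le> \<Delta>\<close> \<open>0 < M\<close> \<open>1 \<le> I\<close>]) (simp add: m_def)
  also have "\<dots> \<le> (\<Sum>i<I. \<Sum>m<2. failure_rate False act outp T M \<omega> (2 * 2 ^ i) m)"
    by (intro sum_mono member_le_sum) (auto simp: m_def failure_rate_nonneg)
  also have "\<dots> \<le> real I * (2 / real n powr c + 2 * (real \<Delta>)\<^sup>2 / real M)"
    using average by (simp add: sum.cartesian_product case_prod_beta card_cartesian_product algebra_simps)
  finally show "exp (- (20 * real E / real I)) \<le> 2 / real n powr c + 2 * (real \<Delta>)\<^sup>2 / real M"
    by (rule mult_left_le_imp_le) (use \<open>1 \<le> I\<close> in simp)
qed

lemma no_cd_energy_ge: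
  fixes act :: "((nat \<Rightarrow> bool) \<times> nat option, 'msg) algorithm"
  assumes "1 \<le> c" "2 \<le> \<Delta>" "\<Delta> + 2 \<le> n"
    and "rand_K2_whp False n c \<Delta> act outp T" "rand_K2_energy False \<Delta> act T E"
  shows "1 / 80 * ln (real \<Delta>) * ln (real n) \<le> real E"
proof -
  obtain I where scales: "2 ^ I \<le> \<Delta>" "\<Delta> < 2 ^ (I + 1)" using ex_power_ivl1[of 2 \<Delta>] assms(2) by auto
  have "1 \<le> I" using scales(2) assms(2) by (cases I) auto
  have n_ge_4: "4 \<le> real n" using assms(2,3) by simp
  have "exp (- (20 * real E / real I)) \<le> 2 / real n powr c"
    by (rule no_cd_failure_probability_ge[OF \<open>1 \<le> I\<close> scales(1) assms(4,5)])
  also have "\<dots> \<le> 2 / real n" using one_div_powr_le_one_div[OF assms(1), of "real n"] n_ge_4 by simp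
  finally have "- (20 * real E / real I) \<le> ln (2 / real n)" using n_ge_4 by (simp add: ln_ge_iff)
  hence "ln (real n) - ln 2 \<le> 20 * real E / real I" using n_ge_4 by (simp add: ln_div)
  moreover have "2 * ln 2 = ln (4 :: real)" using ln_realpow[of 2 2] by simp
  moreover have "ln 4 \<le> ln (real n)" using n_ge_4 by simp
  ultimately have "ln (real n) / 2 \<le> 20 * real E / real I" by linarith
  hence energy: "real I * ln (real n) \<le> 40 * real E" using \<open>1 \<le> I\<close> by (simp add: field_simps)
  have "real \<Delta> \<le> 2 ^ (I + 1)" using scales(2) by (metis less_imp_le of_nat_le_iff of_nat_numeral of_nat_power)
  hence "ln (real \<Delta>) \<le> ln (2 ^ (I + 1))" using assms(2) by simp
  also have "\<dots> = real (I + 1) * ln 2" by (rule ln_realpow)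
  also have "\<dots> \<le> real (I + 1) * 1" using ln_le_minus_one[of "2 :: real"] by (intro mult_left_mono) auto
  finally have "ln (real \<Delta>) \<le> 2 * real I" using \<open>1 \<le> I\<close> by simp
  hence "ln (real \<Delta>) * ln (real n) \<le> 2 * real I * ln (real n)" using n_ge_4 by (intro mult_right_mono) auto
  thus ?thesis using energy by simp
qed

theorem theorem2:
  shows
  "(\<exists>C>0. \<forall>N \<Delta> (act :: nat \<times> nat option \<Rightarrow> 'msg feedback list \<Rightarrow> 'msg action) outp T E.
       1 \<le> \<Delta> \<and> \<Delta> + 2 \<le> N \<and> det_K2_correct False N \<Delta> act outp T \<and> det_K2_energy False N \<Delta> act T E
       \<longrightarrow> real E \<ge> C * real \<Delta>)
   \<and> (\<forall>c::real. c \<ge> 1 \<longrightarrow> (\<exists>C>0. \<forall>n \<Delta> (act :: (nat \<Rightarrow> bool) \<times> nat option \<Rightarrow> 'msg feedback list \<Rightarrow> 'msg action) outp T E.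
       2 \<le> \<Delta> \<and> \<Delta> + 2 \<le> n \<and> rand_K2_whp False n c \<Delta> act outp T \<and> rand_K2_energy False \<Delta> act T E
       \<longrightarrow> real E \<ge> C * ln (real \<Delta>) * ln (real n)))
   \<and> (\<forall>c::real. c \<ge> 1 \<longrightarrow> (\<exists>C>0. \<forall>n \<Delta> (act :: (nat \<Rightarrow> bool) \<times> nat option \<Rightarrow> 'msg feedback list \<Rightarrow> 'msg action) outp T E.
       2 \<le> \<Delta> \<and> \<Delta> + 2 \<le> n \<and> rand_K2_whp True n c \<Delta> act outp T \<and> rand_K2_energy True \<Delta> act T E
       \<longrightarrow> real E \<ge> C * ln (real n)))"
proof (intro conjI allI impI, goal_cases deterministic no_cd cd)
  case deterministic
  show ?case
    by (intro exI[of _ "1 / 2"] conjI allI impI; (elim conjE)?) (simp, drule (2) deterministic_energy_ge, linarith)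
next
  case (no_cd c)
  thus ?case
    by (intro exI[of _ "1 / 80"] conjI allI impI; (elim conjE)?) (simp, rule no_cd_energy_ge)
next
  case (cd c)
  thus ?case
    by (intro exI[of _ "1 / 4"] conjI allI impI; (elim conjE)?) (simp, rule cd_energy_ge)
qed

end
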